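(* For every $\varepsilon > 0$ there exist positive constants $C$, $\delta$, $\beta$ such that the following holds for all integers $\ell$ and $n$ with $\ell \ge C\sqrt{n}$. Let $\mathcal{P} = (M,E)$ be a pregraph on $n$ vertices with $|E| \le \binom{\ell}{2}$ and $|M| \ge (1-\delta)\ell n$. Then either $E$ is $\varepsilon$-close to $K_\ell$, or $\mathcal{P}$ contains at least $\beta\ell^4$ good copies of $C_4$.
   Context: A pregraph on $n$ vertices is a pair $\mathcal{P} = (M,E)$ of disjoint subsets of $E(K_n)$, the edge set of the complete graph on $n$ vertices; elements of $E$ are called edges and elements of $M$ mixed edges. A good copy of $C_4$ in $\mathcal{P}$ is a copy of the $4$-cycle $C_4$ (as a subgraph) all of whose four edges lie in $M$ and whose vertex set is an independent set in the graph $E$ (no pair of its vertices belongs to $E$). A graph $G$ (here, the graph with edge set $E$ on the vertices of $K_n$) is $\varepsilon$-close to $K_\ell$ if one can transform $G$ into a complete graph on some $\ell$ vertices (plus isolated vertices) by adding or deleting at most $\varepsilon\binom{\ell}{2}$ edges. *)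

theory Defs
  imports Complex_Main "HOL-Library.Ramsey"
begin

text \<open>The graph \<open>K\<^sub>n\<close> has vertex set \<open>{..<n}\<close> and edge set \<open>[{..<n}]\<^bsup>2\<^esup>\<close>, its two-element subsets.
  Graphs on a fixed vertex set are represented by their edge sets.\<close>

definition pregraph :: "nat \<Rightarrow> nat set set \<Rightarrow> nat set set \<Rightarrow> bool" where
  "pregraph n M E \<longleftrightarrow> M \<subseteq> [{..<n}]\<^bsup>2\<^esup> \<and> E \<subseteq> [{..<n}]\<^bsup>2\<^esup> \<and> M \<inter> E = {}"

text \<open>Copies of \<open>C\<^sub>4\<close> are unlabelled subgraphs, so that a copy is identified with its set of four
  edges (a set of four vertices spans three copies in \<open>K\<^sub>n\<close>); its vertex set is the union of these.\<close>

definition C4_copies :: "nat \<Rightarrow> nat set set set" where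
  "C4_copies n = {{{a, b}, {b, c}, {c, d}, {d, a}} | a b c d.
     {a, b, c, d} \<subseteq> {..<n} \<and> distinct [a, b, c, d]}"

definition good_C4_copies :: "nat \<Rightarrow> nat set set \<Rightarrow> nat set set \<Rightarrow> nat set set set" where
  "good_C4_copies n M E = {F \<in> C4_copies n. F \<subseteq> M \<and> indep (\<Union>F) E}"

text \<open>\<open>D\<close> is the set of deleted edges and \<open>A\<close> the set of added edges.\<close>

definition close_to_complete :: "real \<Rightarrow> nat \<Rightarrow> nat \<Rightarrow> nat set set \<Rightarrow> bool" where
  "close_to_complete \<epsilon> l n E \<longleftrightarrow>
     (\<exists>U D A. U \<subseteq> {..<n} \<and> card U = l \<and>
        D \<subseteq> E \<and> A \<subseteq> [{..<n}]\<^bsup>2\<^esup> - E \<and> (E - D) \<union> A = [U]\<^bsup>2\<^esup> \<and>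
        real (card D + card A) \<le> \<epsilon> * real (l choose 2))"

end

theory Submission
  imports Defs "HOL-Analysis.Convex"
begin

text \<open>Let \<open>F\<close> be \<open>E\<close> together with the diagonal, \<open>e u\<close> the degree of \<open>u\<close> in \<open>F\<close>, \<open>d u\<close> its degree
  in \<open>M\<close>, and weight \<open>u\<close> by \<open>1 / s u\<close>, where \<open>s u\<close> is \<open>e u\<close> plus a small multiple of \<open>l\<^sup>2 / n\<close>. If there
  are few good copies of \<open>C\<^sub>4\<close>, then for most pairs \<open>x, y\<close> outside \<open>F\<close> the common \<open>M\<close>-neighbourhood of
  \<open>x\<close> and \<open>y\<close> is nearly a clique of \<open>F\<close>, hence has total weight \<open>w x y\<close> at most about 1. Summing over
  the pairs bounds \<open>\<Sum>u. (d u)\<^sup>2 / s u\<close> by about \<open>n\<^sup>2\<close>, where only the vertices of degree much larger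
  than \<open>l\<close> matter. As \<open>\<Sum>u. s u\<close> is at most about \<open>l\<^sup>2\<close>, Cauchy-Schwarz shows that \<open>card M\<close> is at most
  about \<open>l n\<close>, so under the hypothesis on \<open>M\<close> all these estimates are nearly tight. Then the positive
  semidefinite matrix \<open>w\<close>, the weighted sum of the rank one matrices of the neighbourhoods, is close
  to the all-one matrix in the Hilbert-Schmidt norm. Projecting away from the constants, one finds
  that \<open>u\<close> and \<open>v\<close> typically have about \<open>d u d v / n\<close> common neighbours. Since pairs outside \<open>F\<close> have
  few common neighbours, almost all pairs, measured by \<open>(d u)\<^sup>2 / s u \<cdot> (d v)\<^sup>2 / s v\<close> (nearly
  proportional to \<open>s u \<cdot> s v\<close>), lie in \<open>F\<close>. A graph whose degree-weighted pairs are almost all edges is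
  almost a clique.\<close>

section \<open>Gram matrices and elementary inequalities\<close>

lemma sum_swap4:
  "(\<Sum>x\<in>X. \<Sum>y\<in>Y. \<Sum>u\<in>S. \<Sum>v\<in>T. g x y u v) = (\<Sum>u\<in>S. \<Sum>v\<in>T. \<Sum>x\<in>X. \<Sum>y\<in>Y. g x y u v)"
proof -
  have "(\<Sum>x\<in>X. \<Sum>y\<in>Y. \<Sum>u\<in>S. \<Sum>v\<in>T. g x y u v) = (\<Sum>x\<in>X. \<Sum>u\<in>S. \<Sum>y\<in>Y. \<Sum>v\<in>T. g x y u v)"
    by (intro sum.cong refl sum.swap)
  also have "\<dots> = (\<Sum>u\<in>S. \<Sum>x\<in>X. \<Sum>v\<in>T. \<Sum>y\<in>Y. g x y u v)"
    by (subst sum.swap) (intro sum.cong refl sum.swap)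
  also have "\<dots> = (\<Sum>u\<in>S. \<Sum>v\<in>T. \<Sum>x\<in>X. \<Sum>y\<in>Y. g x y u v)"
    by (intro sum.cong refl sum.swap)
  finally show ?thesis .
qed

text \<open>Let \<open>P\<close> be the projection orthogonal to the constants. The bracket is the
  inner product of the projected columns \<open>u\<close> and \<open>v\<close> of \<open>a\<close>,
  so the left side is the squared Hilbert-Schmidt norm of \<open>P w P\<close>, while the right side
  is that of \<open>w\<close> minus that of its constant part. After expansion of the squares only
  Cauchy-Schwarz for the row sums \<open>r\<close> is left.\<close>

lemma gram_variance:
  fixes a :: "'a \<Rightarrow> 'b \<Rightarrow> real" and g :: "'b \<Rightarrow> real"
  assumes "finite X" "X \<noteq> {}" "\<And>u. u \<in> T \<Longrightarrow> g u \<ge> 0"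
  defines "N \<equiv> real (card X)"
    and "w \<equiv> \<lambda>x y. \<Sum>u\<in>T. g u * a x u * a y u"
    and "D \<equiv> \<lambda>u. \<Sum>x\<in>X. a x u"
  shows "(\<Sum>u\<in>T. \<Sum>v\<in>T. g u * g v * ((\<Sum>x\<in>X. a x u * a x v) - D u * D v / N)\<^sup>2)
    \<le> (\<Sum>x\<in>X. \<Sum>y\<in>X. (w x y)\<^sup>2) - (\<Sum>x\<in>X. \<Sum>y\<in>X. w x y)\<^sup>2 / N\<^sup>2"
proof -
  define b where "b u v = (\<Sum>x\<in>X. a x u * a x v)" for u v
  define r where "r x = (\<Sum>u\<in>T. g u * a x u * D u)" for x
  define W where "W = (\<Sum>x\<in>X. r x)"
  have N: "N > 0" using assms by (simp add: N_def card_gt_0_iff)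
  have rw: "(\<Sum>y\<in>X. w x y) = r x" for x
    unfolding w_def r_def D_def sum_distrib_left by (rule sum.swap)
  have I1: "(\<Sum>u\<in>T. \<Sum>v\<in>T. g u * g v * (b u v)\<^sup>2) = (\<Sum>x\<in>X. \<Sum>y\<in>X. (w x y)\<^sup>2)"
  proof -
    have "(\<Sum>x\<in>X. \<Sum>y\<in>X. (w x y)\<^sup>2) =
        (\<Sum>x\<in>X. \<Sum>y\<in>X. \<Sum>u\<in>T. \<Sum>v\<in>T. (g u * a x u * a y u) * (g v * a x v * a y v))"
      by (simp add: w_def power2_eq_square sum_product)
    also have "\<dots> = (\<Sum>u\<in>T. \<Sum>v\<in>T. \<Sum>x\<in>X. \<Sum>y\<in>X. (g u * a x u * a y u) * (g v * a x v * a y v))"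
      by (rule sum_swap4)
    also have "\<dots> = (\<Sum>u\<in>T. \<Sum>v\<in>T. g u * g v * (b u v)\<^sup>2)"
      by (intro sum.cong refl)
        (simp add: b_def power2_eq_square sum_product sum_distrib_left algebra_simps)
    finally show ?thesis by simp
  qed
  have I2: "(\<Sum>u\<in>T. \<Sum>v\<in>T. g u * g v * (b u v * (D u * D v))) = (\<Sum>x\<in>X. (r x)\<^sup>2)"
  proof -
    have "(\<Sum>x\<in>X. (r x)\<^sup>2) = (\<Sum>x\<in>X. \<Sum>u\<in>T. \<Sum>v\<in>T. (g u * a x u * D u) * (g v * a x v * D v))"
      by (simp add: r_def power2_eq_square sum_product)
    also have "\<dots> = (\<Sum>u\<in>T. \<Sum>v\<in>T. \<Sum>x\<in>X. (g u * a x u * D u) * (g v * a x v * D v))"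
      by (subst sum.swap) (intro sum.cong refl sum.swap)
    also have "\<dots> = (\<Sum>u\<in>T. \<Sum>v\<in>T. g u * g v * (b u v * (D u * D v)))"
      by (intro sum.cong refl)
        (simp add: b_def sum_distrib_left sum_distrib_right algebra_simps)
    finally show ?thesis by simp
  qed
  have W: "W = (\<Sum>u\<in>T. g u * (D u)\<^sup>2)"
  proof -
    have "W = (\<Sum>u\<in>T. \<Sum>x\<in>X. g u * a x u * D u)"
      unfolding W_def r_def by (rule sum.swap)
    also have "\<dots> = (\<Sum>u\<in>T. g u * (D u)\<^sup>2)"
      by (intro sum.cong refl)
        (simp add: power2_eq_square D_def sum_distrib_left sum_distrib_right algebra_simps)
    finally show ?thesis .
  qed
  have I3: "(\<Sum>u\<in>T. \<Sum>v\<in>T. g u * g v * (D u * D v)\<^sup>2) = W\<^sup>2"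
  proof -
    have "W\<^sup>2 = (\<Sum>u\<in>T. \<Sum>v\<in>T. (g u * (D u)\<^sup>2) * (g v * (D v)\<^sup>2))"
      by (simp add: W power2_eq_square[of "sum _ _"] sum_product)
    also have "\<dots> = (\<Sum>u\<in>T. \<Sum>v\<in>T. g u * g v * (D u * D v)\<^sup>2)"
      by (intro sum.cong refl) (simp add: power_mult_distrib)
    finally show ?thesis by simp
  qed
  have cs: "W\<^sup>2 \<le> N * (\<Sum>x\<in>X. (r x)\<^sup>2)"
    using sum_squared_le_sum_of_squares[of r X] assms by (simp add: W_def N_def mult.commute)
  have "(\<Sum>u\<in>T. \<Sum>v\<in>T. g u * g v * (b u v - D u * D v / N)\<^sup>2) =
     (\<Sum>u\<in>T. \<Sum>v\<in>T. g u * g v * (b u v)\<^sup>2 - 2 / N * (g u * g v * (b u v * (D u * D v)))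
        + 1 / N\<^sup>2 * (g u * g v * (D u * D v)\<^sup>2))"
    by (intro sum.cong refl) (simp add: power2_eq_square algebra_simps)
  also have "\<dots> = (\<Sum>u\<in>T. \<Sum>v\<in>T. g u * g v * (b u v)\<^sup>2) - 2 / N * (\<Sum>x\<in>X. (r x)\<^sup>2) + 1 / N\<^sup>2 * W\<^sup>2"
    by (simp only: sum.distrib sum_subtractf sum_distrib_left[symmetric] I2 I3)
  also have "\<dots> \<le> (\<Sum>x\<in>X. \<Sum>y\<in>X. (w x y)\<^sup>2) - W\<^sup>2 / N\<^sup>2"
  proof -
    have "W\<^sup>2 / N\<^sup>2 \<le> (\<Sum>x\<in>X. (r x)\<^sup>2) / N"
      using cs N by (simp add: field_simps power2_eq_square)
    then show ?thesis by (simp add: I1)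
  qed
  finally show ?thesis by (simp add: b_def W_def rw)
qed

lemma sum_of_bool_doubleton:
  assumes "finite V" "E \<subseteq> [V]\<^bsup>2\<^esup>"
  shows "(\<Sum>u\<in>V. \<Sum>v\<in>V. of_bool ({u, v} \<in> E)) = 2 * real (card E)"
proof -
  have fE: "finite E" using assms finite_imp_finite_nsets finite_subset by blast
  have *: "(\<Sum>u\<in>V. \<Sum>v\<in>V. of_bool ({u, v} = e)) = (2::real)" if e: "e \<in> E" for e
  proof -
    obtain p q where pq: "e = {p, q}" "p \<noteq> q" "p \<in> V" "q \<in> V"
      using subsetD[OF assms(2) e] by (auto simp: nsets_def card_2_iff)
    have "(\<Sum>u\<in>V. \<Sum>v\<in>V. of_bool ({u, v} = e)) = (\<Sum>u\<in>V. \<Sum>v\<in>V. of_bool (u = p) * of_bool (v = q) + of_bool (u = q) * (of_bool (v = p)::real))"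
      using pq by (intro sum.cong refl) (auto simp: doubleton_eq_iff)
    also have "\<dots> = 2"
      using pq assms(1)
      by (simp add: sum.distrib sum_distrib_left[symmetric] sum_distrib_right[symmetric] of_bool_def sum.delta sum.delta')
    finally show ?thesis .
  qed
  have "(\<Sum>u\<in>V. \<Sum>v\<in>V. of_bool ({u, v} \<in> E)) = (\<Sum>u\<in>V. \<Sum>v\<in>V. \<Sum>e\<in>E. of_bool ({u, v} = e) :: real)"
    using fE by (intro sum.cong refl) (simp add: of_bool_def)
  also have "\<dots> = (\<Sum>u\<in>V. \<Sum>e\<in>E. \<Sum>v\<in>V. of_bool ({u, v} = e))"
    by (intro sum.cong refl sum.swap)
  also have "\<dots> = (\<Sum>e\<in>E. \<Sum>u\<in>V. \<Sum>v\<in>V. of_bool ({u, v} = e))" by (rule sum.swap)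
  also have "\<dots> = 2 * real (card E)" by (simp add: *)
  finally show ?thesis .
qed

text \<open>The inequality \<open>d - L \<le> h\<close> can be nearly tight relative to
  \<open>h\<close> only if \<open>d\<close> is much larger than \<open>L\<close>. This isolates the
  vertices of large degree in \<open>d_T_sum\<close>.\<close>

lemma sqrt_gap_bound:
  fixes d L K :: real
  assumes "0 < L" "d \<le> K * L" "0 \<le> d" "0 \<le> K"
  defines "h \<equiv> sqrt (max 0 (d\<^sup>2 - L\<^sup>2))"
  shows "h \<le> (K + 1) * (h - (d - L))"
proof (cases "d \<le> L")
  case True
  then have "h = 0" using assms by (simp add: h_def power_mono)
  then show ?thesis using True assms by simp
next
  case False
  define p q where "p = sqrt (d - L)" and "q = sqrt (d + L)"
  have p: "p\<^sup>2 = d - L" "p \<ge> 0" and q: "q\<^sup>2 = d + L" "q > 0" "p \<le> q"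
    using False assms by (auto simp: p_def q_def)
  have h: "h = p * q"
  proof -
    have "d\<^sup>2 - L\<^sup>2 = (d - L) * (d + L)" by (simp add: power2_eq_square algebra_simps)
    moreover have "\<dots> \<ge> 0" using False assms by simp
    ultimately show ?thesis by (simp add: h_def p_def q_def real_sqrt_mult max_def)
  qed
  \<comment> \<open>\<open>h - (d - L) = p (q - p)\<close> and \<open>q \<le> (K + 1) (q - p)\<close> because \<open>(q - p) (q + p) = 2 L\<close>.\<close>
  have "q * (q + p) \<le> (K + 1) * (q - p) * (q + p)"
  proof -
    have "q * (q + p) \<le> q * (q + q)" using q by (intro mult_left_mono) auto
    also have "\<dots> = 2 * q\<^sup>2" by (simp add: power2_eq_square)
    also have "\<dots> \<le> (K + 1) * (2 * L)" using q(1) assms(2) by (simp add: algebra_simps)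
    also have "2 * L = (q - p) * (q + p)" using p q by (simp add: power2_eq_square algebra_simps)
    finally show ?thesis by (simp add: mult.assoc)
  qed
  then have "q \<le> (K + 1) * (q - p)" using p q by (simp add: mult_le_cancel_right)
  then have "p * q \<le> p * ((K + 1) * (q - p))" using p by (intro mult_left_mono)
  also have "\<dots> = (K + 1) * (h - (d - L))"
    unfolding h p(1)[symmetric] by (simp add: power2_eq_square algebra_simps)
  finally show ?thesis by (simp add: h)
qed

lemma sqrt_gap_nonneg:
  fixes d L :: real
  assumes "0 < L" "0 \<le> d"
  shows "d - L \<le> sqrt (max 0 (d\<^sup>2 - L\<^sup>2))"
proof (cases "d \<le> L")
  case True
  have "0 \<le> sqrt (max 0 (d\<^sup>2 - L\<^sup>2))" by simp
  with True show ?thesis by linarith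
next
  case False
  have "(d - L)\<^sup>2 \<le> d\<^sup>2 - L\<^sup>2"
  proof -
    have "(d - L) * L \<ge> 0" using False assms by simp
    then show ?thesis by (simp add: power2_eq_square algebra_simps)
  qed
  then show ?thesis by (intro real_le_rsqrt) (simp add: le_max_iff_disj)
qed

text \<open>Equality holds at \<open>h = s * \<mu>\<close>. Summed over vertices with one fixed
  slope \<open>\<mu>\<close>, this replaces Cauchy-Schwarz and keeps the defect visible as a sum of
  squares.\<close>

lemma two_mult_le:
  fixes h s \<mu> :: real
  assumes "s > 0"
  shows "2 * \<mu> * h \<le> h\<^sup>2 / s + s * \<mu>\<^sup>2"
proof -
  have "0 \<le> s * (h / s - \<mu>)\<^sup>2" using assms by simp
  also have "\<dots> = h\<^sup>2 / s - 2 * \<mu> * h + s * \<mu>\<^sup>2"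
    using assms by (simp add: power2_eq_square field_simps)
  finally show ?thesis by simp
qed

section \<open>Setting, weights and error parameters\<close>

locale dense_pregraph =
  fixes V :: "'a set" and adj F :: "'a \<Rightarrow> 'a \<Rightarrow> bool" and l \<psi> :: real
  fixes a f c :: "'a \<Rightarrow> 'a \<Rightarrow> real" and n \<theta> \<kappa> t L :: real and e s d :: "'a \<Rightarrow> real"
  defines "a \<equiv> \<lambda>x u. of_bool (adj x u)"
    and "f \<equiv> \<lambda>x y. of_bool (F x y)"
    and "c \<equiv> \<lambda>x y. of_bool (\<not> F x y)"
    and "n \<equiv> real (card V)"
    and "\<theta> \<equiv> \<psi>\<^sup>2 / 150"
    and "\<kappa> \<equiv> \<theta> ^ 4 / 10"
    and "t \<equiv> \<kappa> * l\<^sup>2 / n"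
    and "L \<equiv> (1 + \<kappa>) * l"
    and "e \<equiv> \<lambda>u. \<Sum>v\<in>V. f u v"
    and "s \<equiv> \<lambda>u. e u + t"
    and "d \<equiv> \<lambda>u. \<Sum>x\<in>V. a x u"
  assumes finV: "finite V" and V_ne: "V \<noteq> {}"
    and F_sym: "\<And>u v. F u v \<longleftrightarrow> F v u"
    and l_pos: "0 < l" and psi: "0 < \<psi>" "\<psi> \<le> 1/100"
    and e_sum: "(\<Sum>u\<in>V. e u) \<le> (1 + \<kappa>) * l\<^sup>2"
    and d_sum: "(\<Sum>u\<in>V. d u) \<ge> 2 * (1 - \<kappa>) * l * n"
    and good: "(\<Sum>x\<in>V. \<Sum>y\<in>V. \<Sum>u\<in>V. \<Sum>v\<in>V. c x y * c u v * (a x u * a y u * (a x v * a y v)))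
       \<le> \<kappa> ^ 3 * l ^ 4"
begin

text \<open>The error scales are nested: \<open>\<psi>\<close> for the final clique;
  \<open>\<theta>\<close> of order \<open>\<psi>^2\<close>, for Markov's inequality over pairs;
  \<open>\<tau> = \<theta>^2\<close>, because the threshold with factor \<open>\<theta>\<close> in
  \<open>X\<close> is squared in \<open>w_F_sum\<close>; and \<open>\<kappa>\<close> of order
  \<open>\<tau>^2\<close>, so that a loss of a factor \<open>1 / \<tau>\<close> in
  \<open>d_T_sum\<close> is affordable.\<close>

definition \<tau> where "\<tau> = \<theta>\<^sup>2"

definition w :: "'a set \<Rightarrow> 'a \<Rightarrow> 'a \<Rightarrow> real" where
  "w T x y = (\<Sum>u\<in>T. a x u * a y u / s u)"

definition q :: "'a \<Rightarrow> real" where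
  "q u = (\<Sum>x\<in>V. \<Sum>y\<in>V. a x u * a y u * c x y)"

lemma n_pos: "n > 0" using finV V_ne by (simp add: n_def card_gt_0_iff)

lemma theta: "0 < \<theta>" "\<theta> \<le> 1/10000" "150 * \<theta> = \<psi>\<^sup>2" "\<theta> \<le> \<psi> / 100"
proof -
  show "0 < \<theta>" "150 * \<theta> = \<psi>\<^sup>2" using psi by (auto simp: \<theta>_def)
  have "\<psi>\<^sup>2 \<le> \<psi> * (1/100)" using psi by (simp add: power2_eq_square)
  then show "\<theta> \<le> 1/10000" "\<theta> \<le> \<psi> / 100" using psi by (auto simp: \<theta>_def)
qed

lemma tau: "0 < \<tau>" "\<tau> \<le> \<theta> / 10000" "\<tau> \<le> 1/10000"
proof -
  show "0 < \<tau>" using theta by (simp add: \<tau>_def)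
  show *: "\<tau> \<le> \<theta> / 10000"
    using mult_left_mono[OF theta(2), of \<theta>] theta by (simp add: \<tau>_def power2_eq_square)
  show "\<tau> \<le> 1/10000" using * theta by simp
qed

lemma kappa: "\<kappa> = \<tau>\<^sup>2 / 10" "0 < \<kappa>" "\<kappa> \<le> \<tau> / 100"
proof -
  show k: "\<kappa> = \<tau>\<^sup>2 / 10" by (simp add: \<kappa>_def \<tau>_def)
  show "0 < \<kappa>" unfolding k using tau(1) by simp
  show "\<kappa> \<le> \<tau> / 100" using mult_left_mono[OF tau(3), of \<tau>] tau by (simp add: k power2_eq_square)
qed

lemma t_pos: "t > 0" using kappa l_pos n_pos by (simp add: t_def)

lemma e_nonneg: "e u \<ge> 0" by (auto simp: e_def f_def intro: sum_nonneg)
lemma s_ge: "s u \<ge> t" "s u \<ge> e u" "s u > 0" "s u \<ge> 0"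
  using e_nonneg[of u] t_pos by (auto simp: s_def)

lemma d_nonneg: "d u \<ge> 0" by (auto simp: d_def a_def intro: sum_nonneg)
lemma d_le: "d u \<le> n"
proof -
  have "d u \<le> (\<Sum>x\<in>V. 1)" unfolding d_def by (intro sum_mono) (simp add: a_def)
  then show ?thesis by (simp add: n_def)
qed

lemma a01: "a x u \<ge> 0" "a x u \<le> 1" "a x u * a x u = a x u" by (auto simp: a_def)
lemma f01: "f x u \<ge> 0" "f x u \<le> 1" by (auto simp: f_def)
lemma c01: "c x u \<ge> 0" "c x u \<le> 1" "c x u = 1 - f x u" "c x u + f x u = 1"
  by (auto simp: c_def f_def)
lemma f_commute: "f x u = f u x" using F_sym by (simp add: f_def)

lemma L_ge: "l \<le> L" "L > 0" "(\<Sum>u\<in>V. e u) \<le> L\<^sup>2" "(1 + \<kappa>) * l\<^sup>2 \<le> L\<^sup>2"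
proof -
  show "l \<le> L" "L > 0" using kappa l_pos by (auto simp: L_def)
  have "1 + \<kappa> \<le> (1 + \<kappa>)\<^sup>2" using kappa by (simp add: power2_eq_square algebra_simps)
  then have "(1 + \<kappa>) * l\<^sup>2 \<le> (1 + \<kappa>)\<^sup>2 * l\<^sup>2" using l_pos by simp
  then show "(1 + \<kappa>) * l\<^sup>2 \<le> L\<^sup>2" by (simp add: L_def power_mult_distrib)
  with e_sum show "(\<Sum>u\<in>V. e u) \<le> L\<^sup>2" by simp
qed

lemma s_sum: "(\<Sum>u\<in>V. s u) \<le> (1 + 2 * \<kappa>) * l\<^sup>2" "(\<Sum>u\<in>V. s u) = (\<Sum>u\<in>V. e u) + \<kappa> * l\<^sup>2"
proof -
  show *: "(\<Sum>u\<in>V. s u) = (\<Sum>u\<in>V. e u) + \<kappa> * l\<^sup>2"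
    using n_pos by (simp add: s_def sum.distrib t_def n_def)
  show "(\<Sum>u\<in>V. s u) \<le> (1 + 2 * \<kappa>) * l\<^sup>2" using e_sum unfolding * by (simp add: algebra_simps)
qed

section \<open>Weights of common neighbourhoods of non-edges\<close>

lemma w_nonneg: "w T x y \<ge> 0"
  unfolding w_def using a01 s_ge by (intro sum_nonneg) (simp add: less_imp_le)

lemma w_mono: "T \<subseteq> V \<Longrightarrow> w T x y \<le> w T x x"
  unfolding w_def using s_ge(4) by (intro sum_mono divide_right_mono) (auto simp: a_def)

text \<open>If \<open>W\<close> is a clique of \<open>F\<close>, then every element of \<open>W\<close> has degree at least \<open>card W\<close>, and hence
  its reciprocal weights add up to at most 1. In general the excess is paid for by non-edges.\<close>

lemma sum_inverse_weights:
  assumes T: "T \<subseteq> V" and b: "\<And>u. 0 \<le> b u" "\<And>u. b u \<le> (1::real)"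
  shows "(\<Sum>u\<in>T. b u / s u)\<^sup>2 \<le> (\<Sum>u\<in>T. b u / s u) + (\<Sum>u\<in>T. \<Sum>v\<in>T. b u * b v * c u v / (s u * s v))"
proof -
  define g where "g u = b u / s u" for u
  have g: "0 \<le> g u" for u using b s_ge by (simp add: g_def)
  have "(\<Sum>u\<in>T. g u)\<^sup>2 = (\<Sum>u\<in>T. \<Sum>v\<in>T. g u * g v * f u v) + (\<Sum>u\<in>T. \<Sum>v\<in>T. g u * g v * c u v)"
    by (simp add: power2_eq_square sum_product c01 algebra_simps sum.distrib[symmetric])
  moreover have "(\<Sum>u\<in>T. \<Sum>v\<in>T. g u * g v * f u v) \<le> (\<Sum>u\<in>T. g u)"
  proof -
    \<comment> \<open>The arithmetic-geometric mean inequality decouples the two vertices: by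
      symmetry, \<open>u\<close> then receives \<open>b u / (s u)^2\<close> once for each of its
      \<open>F\<close>-neighbours in \<open>T\<close>, of which there are at most
      \<open>s u\<close>.\<close>
    have 1: "g u * g v * f u v \<le> (b u * (f u v / (s u)\<^sup>2) + b v * (f v u / (s v)\<^sup>2)) / 2" for u v
    proof -
      have "g u * g v \<le> ((g u)\<^sup>2 + (g v)\<^sup>2) / 2"
        using sum_squares_bound[of "g u" "g v"] by simp
      also have "\<dots> \<le> (b u / (s u)\<^sup>2 + b v / (s v)\<^sup>2) / 2"
      proof -
        have "(b u)\<^sup>2 \<le> b u" for u using b[of u] by (simp add: power2_eq_square mult_left_le)
        then have "(g u)\<^sup>2 \<le> b u / (s u)\<^sup>2" for u
          unfolding g_def power_divide by (intro divide_right_mono) auto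
        then show ?thesis by (intro divide_right_mono add_mono) auto
      qed
      finally have "g u * g v * f u v \<le> (b u / (s u)\<^sup>2 + b v / (s v)\<^sup>2) / 2 * f u v"
        using f01 by (intro mult_right_mono)
      then show ?thesis using f_commute[of u v] by (simp add: algebra_simps)
    qed
    define Q where "Q = (\<Sum>u\<in>T. \<Sum>v\<in>T. b u * (f u v / (s u)\<^sup>2))"
    have "(\<Sum>u\<in>T. \<Sum>v\<in>T. g u * g v * f u v)
        \<le> (\<Sum>u\<in>T. \<Sum>v\<in>T. (b u * (f u v / (s u)\<^sup>2) + b v * (f v u / (s v)\<^sup>2)) / 2)"
      by (intro sum_mono 1)
    also have "\<dots> = (Q + (\<Sum>u\<in>T. \<Sum>v\<in>T. b v * (f v u / (s v)\<^sup>2))) / 2"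
      by (simp add: sum_divide_distrib[symmetric] sum.distrib Q_def)
    also have "(\<Sum>u\<in>T. \<Sum>v\<in>T. b v * (f v u / (s v)\<^sup>2)) = Q" unfolding Q_def by (rule sum.swap)
    also have "(Q + Q) / 2 = (\<Sum>u\<in>T. b u * ((\<Sum>v\<in>T. f u v) / (s u)\<^sup>2))"
      by (simp add: Q_def sum_distrib_left sum_divide_distrib)
    also have "\<dots> \<le> (\<Sum>u\<in>T. b u * (s u / (s u)\<^sup>2))"
    proof (intro sum_mono mult_left_mono divide_right_mono)
      fix u
      have "(\<Sum>v\<in>T. f u v) \<le> e u"
        unfolding e_def using T finV f01 by (intro sum_mono2) auto
      then show "(\<Sum>v\<in>T. f u v) \<le> s u" using s_ge(2)[of u] by simp
    qed (use b in auto)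
    also have "\<dots> = (\<Sum>u\<in>T. g u)"
      using s_ge by (intro sum.cong refl) (simp add: g_def power2_eq_square)
    finally show ?thesis .
  qed
  ultimately show ?thesis by (simp add: g_def)
qed

lemma w_square_le:
  assumes "T \<subseteq> V"
  shows "(w T x y)\<^sup>2 \<le> w T x y +
    (\<Sum>u\<in>T. \<Sum>v\<in>T. (a x u * a y u) * (a x v * a y v) * c u v / (s u * s v))"
  unfolding w_def by (rule sum_inverse_weights[OF assms]) (auto simp: a_def)

text \<open>The term \<open>t\<close> is part of \<open>s\<close> for the sake of this bound: all
  weights are at least \<open>t\<close>, and \<open>t = \<kappa> * l^2 / n\<close> is such that the
  bound in \<open>good\<close> divided by \<open>t * t\<close> becomes
  \<open>\<kappa> * n^2\<close>.\<close>

lemma good_weight: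
  assumes T: "T \<subseteq> V"
  shows "(\<Sum>x\<in>V. \<Sum>y\<in>V. c x y *
     (\<Sum>u\<in>T. \<Sum>v\<in>T. (a x u * a y u) * (a x v * a y v) * c u v / (s u * s v))) \<le> \<kappa> * n\<^sup>2"
proof -
  define g where "g x y u v = c x y * c u v * (a x u * a y u * (a x v * a y v))" for x y u v
  have g: "g x y u v \<ge> 0" for x y u v using a01 c01 by (simp add: g_def)
  have "(\<Sum>x\<in>V. \<Sum>y\<in>V. c x y *
     (\<Sum>u\<in>T. \<Sum>v\<in>T. (a x u * a y u) * (a x v * a y v) * c u v / (s u * s v)))
     = (\<Sum>x\<in>V. \<Sum>y\<in>V. \<Sum>u\<in>T. \<Sum>v\<in>T. g x y u v / (s u * s v))"
    by (intro sum.cong refl) (simp add: sum_distrib_left g_def algebra_simps)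
  also have "\<dots> \<le> (\<Sum>x\<in>V. \<Sum>y\<in>V. \<Sum>u\<in>T. \<Sum>v\<in>T. g x y u v / (t * t))"
    using g s_ge t_pos by (intro sum_mono divide_left_mono mult_mono) auto
  also have "\<dots> \<le> (\<Sum>x\<in>V. \<Sum>y\<in>V. \<Sum>u\<in>V. \<Sum>v\<in>V. g x y u v / (t * t))"
  proof (intro sum_mono)
    fix x y
    have "(\<Sum>u\<in>T. \<Sum>v\<in>T. g x y u v / (t * t)) \<le> (\<Sum>u\<in>T. \<Sum>v\<in>V. g x y u v / (t * t))"
      using T finV g t_pos by (intro sum_mono sum_mono2) auto
    also have "\<dots> \<le> (\<Sum>u\<in>V. \<Sum>v\<in>V. g x y u v / (t * t))"
      using T finV g t_pos by (intro sum_mono2 sum_nonneg) auto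
    finally show "(\<Sum>u\<in>T. \<Sum>v\<in>T. g x y u v / (t * t)) \<le> (\<Sum>u\<in>V. \<Sum>v\<in>V. g x y u v / (t * t))" .
  qed
  also have "\<dots> = (\<Sum>x\<in>V. \<Sum>y\<in>V. \<Sum>u\<in>V. \<Sum>v\<in>V. g x y u v) / (t * t)"
    by (simp add: sum_divide_distrib)
  also have "\<dots> \<le> \<kappa> ^ 3 * l ^ 4 / (t * t)"
    using good t_pos by (intro divide_right_mono) (auto simp: g_def)
  also have "\<dots> = \<kappa> * n\<^sup>2"
    using kappa(2) l_pos n_pos by (simp add: t_def field_simps power2_eq_square power3_eq_cube power4_eq_xxxx)
  finally show ?thesis .
qed

lemma w_excess:
  assumes "T \<subseteq> V"
  shows "(\<Sum>x\<in>V. \<Sum>y\<in>V. c x y * ((w T x y)\<^sup>2 - w T x y)) \<le> \<kappa> * n\<^sup>2"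
proof -
  have "c x y * ((w T x y)\<^sup>2 - w T x y) \<le> c x y *
     (\<Sum>u\<in>T. \<Sum>v\<in>T. (a x u * a y u) * (a x v * a y v) * c u v / (s u * s v))" for x y
    using w_square_le[OF assms, of x y] c01 by (intro mult_left_mono) auto
  then show ?thesis by (intro order_trans[OF _ good_weight[OF assms]] sum_mono)
qed

lemma c_sum: "(\<Sum>x\<in>V. \<Sum>y\<in>V. c x y) \<le> n\<^sup>2"
proof -
  have "(\<Sum>x\<in>V. \<Sum>y\<in>V. c x y) \<le> (\<Sum>x\<in>V. \<Sum>y\<in>V. 1)" using c01 by (intro sum_mono)
  then show ?thesis by (simp add: n_def power2_eq_square)
qed

lemma w_sum: "(\<Sum>x\<in>V. \<Sum>y\<in>V. c x y * w T x y) = (\<Sum>u\<in>T. q u / s u)"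
proof -
  have "(\<Sum>x\<in>V. \<Sum>y\<in>V. c x y * w T x y) = (\<Sum>x\<in>V. \<Sum>u\<in>T. \<Sum>y\<in>V. c x y * (a x u * a y u / s u))"
    unfolding w_def sum_distrib_left by (intro sum.cong refl sum.swap)
  also have "\<dots> = (\<Sum>u\<in>T. \<Sum>x\<in>V. \<Sum>y\<in>V. c x y * (a x u * a y u / s u))" by (rule sum.swap)
  also have "\<dots> = (\<Sum>u\<in>T. q u / s u)"
    by (intro sum.cong refl) (simp add: q_def sum_divide_distrib mult.commute)
  finally show ?thesis .
qed

text \<open>As \<open>(w - 1)^2\<close> is nonnegative, \<open>w\<close> is at most
  \<open>(w^2 - w) + 1\<close>, so the excess bound alone controls the total of \<open>w\<close>
  over non-edges.\<close>

lemma w_sum_le: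
  assumes "T \<subseteq> V"
  shows "(\<Sum>x\<in>V. \<Sum>y\<in>V. c x y * w T x y) \<le> (1 + \<kappa>) * n\<^sup>2"
proof -
  have "c x y * w T x y \<le> c x y * ((w T x y)\<^sup>2 - w T x y) + c x y" for x y
  proof -
    have "w T x y \<le> (w T x y)\<^sup>2 - w T x y + 1"
      using zero_le_power2[of "w T x y - 1"] by (simp add: power2_eq_square algebra_simps)
    then show ?thesis using mult_left_mono[OF _ c01(1), of "w T x y" _ x y] by (fastforce simp: algebra_simps)
  qed
  then have "(\<Sum>x\<in>V. \<Sum>y\<in>V. c x y * w T x y) \<le>
      (\<Sum>x\<in>V. \<Sum>y\<in>V. c x y * ((w T x y)\<^sup>2 - w T x y) + c x y)"
    by (intro sum_mono)
  also have "\<dots> \<le> \<kappa> * n\<^sup>2 + n\<^sup>2"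
    using w_excess[OF assms] c_sum by (simp add: sum.distrib)
  finally show ?thesis by (simp add: algebra_simps)
qed

section \<open>Degrees and near equality in Cauchy-Schwarz\<close>

lemma q_ge: "q u \<ge> 0" "q u \<ge> (d u)\<^sup>2 - L\<^sup>2"
proof -
  show "q u \<ge> 0" unfolding q_def using a01 c01 by (intro sum_nonneg) simp
  have d2: "(d u)\<^sup>2 = (\<Sum>x\<in>V. \<Sum>y\<in>V. a x u * a y u)"
    by (simp add: d_def power2_eq_square sum_product)
  \<comment> \<open>Of the \<open>(d u)^2\<close> ordered pairs of neighbours of \<open>u\<close>,
    only those in \<open>F\<close> are missing from \<open>q u\<close>, and \<open>F\<close> has at
    most \<open>L^2\<close> ordered pairs altogether.\<close>
  have "(d u)\<^sup>2 \<le> q u + (\<Sum>x\<in>V. \<Sum>y\<in>V. f x y)"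
    unfolding d2 q_def sum.distrib[symmetric]
    by (intro sum_mono) (auto simp: a_def c_def f_def)
  then show "q u \<ge> (d u)\<^sup>2 - L\<^sup>2" using L_ge(3) by (simp add: e_def)
qed

text \<open>Heavy vertices: above this threshold the loss \<open>L^2\<close> in \<open>q_ge\<close>
  is at most the fraction \<open>\<tau>^2\<close> of \<open>(d u)^2\<close>.\<close>

definition T where "T = {u \<in> V. d u > L / \<tau>}"

lemma T_sub: "T \<subseteq> V" by (auto simp: T_def)
lemma finT: "finite T" using T_sub finV finite_subset by blast

text \<open>About \<open>l * n\<close> is all that \<open>T\<close> can be expected to carry: in the
  extremal example a clique of \<open>l\<close> vertices is joined to all others by mixed edges, and
  the others have degree \<open>l\<close> each. Hence \<open>d u\<close> is split into
  \<open>L\<close> and \<open>d u - L\<close>, the latter being at most \<open>h u\<close>. The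
  weights bound the sum of \<open>h\<close> by about \<open>l * n\<close> and the degree hypothesis
  bounds that of \<open>d u - L\<close> from below by about the same, so the total slack
  \<open>g\<close> is small.\<close>

lemma d_T_sum: "(\<Sum>u\<in>T. d u) \<ge> (1 - \<tau>) * l * n"
proof -
  define h where "h u = sqrt (max 0 ((d u)\<^sup>2 - L\<^sup>2))" for u
  have h0: "h u \<ge> 0" for u by (simp add: h_def)
  have hq: "(h u)\<^sup>2 \<le> q u" for u using q_ge[of u] by (simp add: h_def)
  have hd: "h u \<le> d u" for u
    using d_nonneg[of u] by (auto simp: h_def intro!: real_le_lsqrt)
  \<comment> \<open>This slope balances the two terms: \<open>q u / s u\<close> and
    \<open>s u * \<mu>^2\<close> both have sums bounded by about \<open>n^2\<close>.\<close>
  define \<mu> where "\<mu> = n / l"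
  have lam: "\<mu> > 0" "\<mu> * l = n" using l_pos n_pos by (auto simp: \<mu>_def)
  have "2 * \<mu> * (\<Sum>u\<in>V. h u) \<le> (\<Sum>u\<in>V. q u / s u + s u * \<mu>\<^sup>2)"
    unfolding sum_distrib_left
  proof (intro sum_mono)
    fix u
    have "2 * \<mu> * h u \<le> (h u)\<^sup>2 / s u + s u * \<mu>\<^sup>2" by (intro two_mult_le s_ge)
    also have "(h u)\<^sup>2 / s u \<le> q u / s u" using hq s_ge by (intro divide_right_mono) auto
    finally show "2 * \<mu> * h u \<le> q u / s u + s u * \<mu>\<^sup>2" by simp
  qed
  also have "\<dots> = (\<Sum>u\<in>V. q u / s u) + (\<Sum>u\<in>V. s u) * \<mu>\<^sup>2"
    by (simp add: sum.distrib sum_distrib_right)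
  also have "\<dots> \<le> (1 + \<kappa>) * n\<^sup>2 + ((1 + 2 * \<kappa>) * l\<^sup>2) * \<mu>\<^sup>2"
    using w_sum_le[of V] s_sum by (intro add_mono mult_right_mono) (auto simp: w_sum)
  also have "\<dots> = 2 * \<mu> * ((1 + 3/2 * \<kappa>) * l * n)"
    unfolding lam(2)[symmetric] by (simp add: algebra_simps power2_eq_square)
  finally have hsum: "(\<Sum>u\<in>V. h u) \<le> (1 + 3/2 * \<kappa>) * l * n"
    using lam(1) by simp
  define g where "g u = h u - (d u - L)" for u
  have g0: "g u \<ge> 0" for u
    using sqrt_gap_nonneg[OF L_ge(2) d_nonneg[of u]] by (simp add: g_def h_def)
  have gsum: "(\<Sum>u\<in>V. g u) \<le> 5 * \<kappa> * (l * n)"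
  proof -
    have "(\<Sum>u\<in>V. g u) = (\<Sum>u\<in>V. h u) - (\<Sum>u\<in>V. d u) + L * n"
      by (simp add: g_def sum_subtractf n_def)
    also have "\<dots> \<le> (1 + 3/2 * \<kappa>) * l * n - 2 * (1 - \<kappa>) * l * n + (1 + \<kappa>) * l * n"
      using hsum d_sum by (simp add: L_def)
    also have "\<dots> = 9/2 * \<kappa> * (l * n)" by (simp add: algebra_simps)
    also have "\<dots> \<le> 5 * \<kappa> * (l * n)" using kappa l_pos n_pos by (intro mult_right_mono) auto
    finally show ?thesis .
  qed
  \<comment> \<open>Off \<open>T\<close>, \<open>sqrt_gap_bound\<close> applies with
    \<open>K = 1 / \<tau>\<close>: the values of \<open>h\<close> there are paid for by the slack
    \<open>g\<close>.\<close>
  have "(\<Sum>u\<in>V-T. h u) \<le> (\<Sum>u\<in>V-T. (1 / \<tau> + 1) * g u)"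
  proof (intro sum_mono)
    fix u assume "u \<in> V - T"
    then have "d u \<le> 1 / \<tau> * L" by (auto simp: T_def)
    then show "h u \<le> (1 / \<tau> + 1) * g u"
      unfolding h_def g_def using d_nonneg[of u] L_ge(2) tau
      by (intro sqrt_gap_bound) auto
  qed
  also have "\<dots> \<le> (1 / \<tau> + 1) * (\<Sum>u\<in>V. g u)"
    unfolding sum_distrib_left[symmetric] using g0 tau finV
    by (intro mult_left_mono sum_mono2) auto
  also have "\<dots> \<le> (1 / \<tau> + 1) * (5 * \<kappa> * (l * n))"
    using gsum tau by (intro mult_left_mono) auto
  also have "\<dots> = (\<tau> / 2 + \<tau>\<^sup>2 / 2) * (l * n)"
    using tau by (simp add: kappa(1) field_simps power2_eq_square)
  finally have out: "(\<Sum>u\<in>V-T. h u) \<le> (\<tau> / 2 + \<tau>\<^sup>2 / 2) * (l * n)" .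
  have "(1 - 3 * \<kappa>) * (l * n) = 2 * (1 - \<kappa>) * l * n - L * n" by (simp add: L_def algebra_simps)
  also have "\<dots> \<le> (\<Sum>u\<in>V. d u - L)" using d_sum by (simp add: sum_subtractf n_def)
  also have "\<dots> \<le> (\<Sum>u\<in>V. h u)" using g0 by (intro sum_mono) (simp add: g_def)
  also have "\<dots> = (\<Sum>u\<in>T. h u) + (\<Sum>u\<in>V-T. h u)"
    using sum.subset_diff[OF T_sub finV, of h] by simp
  finally have "(1 - 3 * \<kappa> - \<tau> / 2 - \<tau>\<^sup>2 / 2) * (l * n) \<le> (\<Sum>u\<in>T. h u)"
    using out by (simp add: algebra_simps)
  moreover have "(1 - \<tau>) * (l * n) \<le> (1 - 3 * \<kappa> - \<tau> / 2 - \<tau>\<^sup>2 / 2) * (l * n)"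
  proof (intro mult_right_mono)
    have "\<tau>\<^sup>2 \<le> \<tau> / 100" using mult_left_mono[OF tau(3), of \<tau>] tau by (simp add: power2_eq_square)
    then show "1 - \<tau> \<le> 1 - 3 * \<kappa> - \<tau> / 2 - \<tau>\<^sup>2 / 2" using kappa tau by simp
  qed (use l_pos n_pos in auto)
  moreover have "(\<Sum>u\<in>T. h u) \<le> (\<Sum>u\<in>T. d u)" using hd by (intro sum_mono)
  ultimately show ?thesis by (simp add: mult.assoc)
qed

section \<open>Heavy vertices: existence and mass\<close>

lemma T_ne: "T \<noteq> {}"
proof
  assume "T = {}"
  then have "(1 - \<tau>) * l * n \<le> 0" using d_T_sum by simp
  moreover have "(1 - \<tau>) * l * n > 0" using tau l_pos n_pos by simp
  ultimately show False by simp
qed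

text \<open>A heavy vertex has degree above \<open>L / \<tau>\<close>, and no degree exceeds
  \<open>n\<close>. This is also the source of \<open>l_le_n\<close>.\<close>

lemma L_le: "L \<le> \<tau> * n"
proof -
  obtain u where "u \<in> T" using T_ne by blast
  then have "L / \<tau> < d u" by (simp add: T_def)
  then have "L / \<tau> \<le> n" using d_le[of u] by simp
  then show ?thesis using tau by (simp add: field_simps)
qed

text \<open>For \<open>u\<close> in \<open>T\<close> this is the contribution of \<open>u\<close> to
  the sum of all entries of \<open>w T\<close>; it serves as the mass of \<open>u\<close> from here
  on.\<close>

definition m where "m u = (d u)\<^sup>2 / s u"
definition \<mu> where "\<mu> = n / l"

lemma mu: "\<mu> > 0" "\<mu> * l = n" "\<mu>\<^sup>2 * l\<^sup>2 = n\<^sup>2"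
proof -
  show "\<mu> > 0" "\<mu> * l = n" using l_pos n_pos by (auto simp: \<mu>_def)
  then show "\<mu>\<^sup>2 * l\<^sup>2 = n\<^sup>2" by (metis power_mult_distrib)
qed

lemma m_nonneg: "m u \<ge> 0" using s_ge by (simp add: m_def)

lemma mu_d_T_sum: "2 * \<mu> * (\<Sum>u\<in>T. d u) \<ge> 2 * (1 - \<tau>) * n\<^sup>2"
proof -
  have "2 * \<mu> * ((1 - \<tau>) * l * n) \<le> 2 * \<mu> * (\<Sum>u\<in>T. d u)"
    using d_T_sum mu by (intro mult_left_mono) auto
  moreover have "2 * \<mu> * ((1 - \<tau>) * l * n) = 2 * (1 - \<tau>) * n\<^sup>2"
    unfolding mu(2)[symmetric] by (simp add: power2_eq_square algebra_simps)
  ultimately show ?thesis by simp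
qed

lemma s_V_mu: "\<mu>\<^sup>2 * (\<Sum>u\<in>V. s u) \<le> (1 + 2 * \<kappa>) * n\<^sup>2"
proof -
  have "\<mu>\<^sup>2 * (\<Sum>u\<in>V. s u) \<le> \<mu>\<^sup>2 * ((1 + 2 * \<kappa>) * l\<^sup>2)"
    using s_sum by (intro mult_left_mono) auto
  also have "\<dots> = (1 + 2 * \<kappa>) * (\<mu>\<^sup>2 * l\<^sup>2)" by simp
  finally show ?thesis by (simp add: mu)
qed

lemma s_T_le: "(\<Sum>u\<in>T. s u) \<le> (\<Sum>u\<in>V. s u)"
  using T_sub finV s_ge by (intro sum_mono2) auto

text \<open>This is the defect in Cauchy-Schwarz. When it is small, \<open>d u\<close> is typically
  about \<open>\<mu> * s u\<close> on \<open>T\<close>, so that the masses \<open>m u\<close> and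
  \<open>\<mu>^2 * s u\<close> nearly agree.\<close>

lemma deviation_sum:
  "(\<Sum>u\<in>T. s u * (d u / s u - \<mu>)\<^sup>2) = (\<Sum>u\<in>T. m u) - 2 * \<mu> * (\<Sum>u\<in>T. d u) + \<mu>\<^sup>2 * (\<Sum>u\<in>T. s u)"
proof -
  have "s u * (d u / s u - \<mu>)\<^sup>2 = m u - 2 * \<mu> * d u + \<mu>\<^sup>2 * s u" for u
    using s_ge(3)[of u] by (simp add: m_def power2_eq_square field_simps)
  then show ?thesis by (simp add: sum.distrib sum_subtractf sum_distrib_left)
qed

text \<open>Nonnegativity of the defect makes the sums of \<open>m u\<close> and of
  \<open>\<mu>^2 * s u\<close> add up to at least about \<open>2 * n^2\<close>. An upper bound of
  about \<open>n^2\<close> on either one thus becomes a lower bound on the other.\<close>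

lemma m_sum_ge: "(\<Sum>u\<in>T. m u) \<ge> (1 - 3 * \<tau>) * n\<^sup>2"
  and s_T_ge: "\<mu>\<^sup>2 * (\<Sum>u\<in>T. s u) \<ge> 2 * (1 - \<tau>) * n\<^sup>2 - (\<Sum>u\<in>T. m u)"
proof -
  have "0 \<le> (\<Sum>u\<in>T. s u * (d u / s u - \<mu>)\<^sup>2)" using s_ge by (intro sum_nonneg) simp
  then show *: "\<mu>\<^sup>2 * (\<Sum>u\<in>T. s u) \<ge> 2 * (1 - \<tau>) * n\<^sup>2 - (\<Sum>u\<in>T. m u)"
    using mu_d_T_sum unfolding deviation_sum by linarith
  have "\<mu>\<^sup>2 * (\<Sum>u\<in>T. s u) \<le> (1 + 2 * \<kappa>) * n\<^sup>2"
    using s_V_mu mult_left_mono[OF s_T_le, of "\<mu>\<^sup>2"] by simp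
  also have "\<dots> \<le> (1 + \<tau>) * n\<^sup>2" using kappa tau by (intro mult_right_mono) auto
  finally show "(\<Sum>u\<in>T. m u) \<ge> (1 - 3 * \<tau>) * n\<^sup>2" using * by (simp add: algebra_simps)
qed

lemma q_T_ge: "u \<in> T \<Longrightarrow> (1 - \<tau>\<^sup>2) * m u \<le> q u / s u"
proof -
  assume "u \<in> T"
  then have "L \<le> \<tau> * d u" using tau by (simp add: T_def field_simps)
  then have "L\<^sup>2 \<le> (\<tau> * d u)\<^sup>2" using L_ge by (intro power_mono) auto
  then have "(1 - \<tau>\<^sup>2) * (d u)\<^sup>2 \<le> q u" using q_ge(2)[of u] by (simp add: algebra_simps)
  then have "(1 - \<tau>\<^sup>2) * (d u)\<^sup>2 / s u \<le> q u / s u" using s_ge by (intro divide_right_mono) auto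
  then show ?thesis by (simp add: m_def)
qed

section \<open>Mean square distance of \<open>w\<close> from the all-one matrix\<close>

lemma w_sum_ge_m: "(1 - \<tau>\<^sup>2) * (\<Sum>u\<in>T. m u) \<le> (\<Sum>x\<in>V. \<Sum>y\<in>V. c x y * w T x y)"
  unfolding w_sum sum_distrib_left by (intro sum_mono q_T_ge)

lemma tau_sq: "\<tau>\<^sup>2 \<le> \<tau> / 10000" "\<tau>\<^sup>2 \<ge> 0"
  using mult_left_mono[OF tau(3), of \<tau>] tau by (auto simp: power2_eq_square)

lemma m_sum_le: "(\<Sum>u\<in>T. m u) \<le> (1 + 2 * \<tau>) * n\<^sup>2"
proof -
  have "(1 - \<tau>\<^sup>2) * (\<Sum>u\<in>T. m u) \<le> (1 + \<kappa>) * n\<^sup>2"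
    using w_sum_ge_m w_sum_le[OF T_sub] by simp
  also have "\<dots> \<le> ((1 - \<tau>\<^sup>2) * (1 + 2 * \<tau>)) * n\<^sup>2"
  proof (intro mult_right_mono)
    have "\<tau>\<^sup>2 * (2 * \<tau>) \<le> \<tau>\<^sup>2" using tau by (intro mult_left_le) auto
    moreover have "(1 - \<tau>\<^sup>2) * (1 + 2 * \<tau>) = 1 + 2 * \<tau> - \<tau>\<^sup>2 - \<tau>\<^sup>2 * (2 * \<tau>)"
      by (simp add: algebra_simps)
    ultimately show "1 + \<kappa> \<le> (1 - \<tau>\<^sup>2) * (1 + 2 * \<tau>)"
      using kappa(3) tau_sq tau by linarith
  qed auto
  finally have "(1 - \<tau>\<^sup>2) * (\<Sum>u\<in>T. m u) \<le> (1 - \<tau>\<^sup>2) * ((1 + 2 * \<tau>) * n\<^sup>2)" by (simp add: mult.assoc)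
  moreover have "1 - \<tau>\<^sup>2 > 0" using tau_sq tau by simp
  ultimately show ?thesis by simp
qed

lemma w_sum_ge: "(\<Sum>x\<in>V. \<Sum>y\<in>V. c x y * w T x y) \<ge> (1 - 4 * \<tau>) * n\<^sup>2"
proof -
  have "(1 - 4 * \<tau>) * n\<^sup>2 \<le> ((1 - \<tau>\<^sup>2) * (1 - 3 * \<tau>)) * n\<^sup>2"
  proof (intro mult_right_mono)
    have "0 \<le> \<tau>\<^sup>2 * (3 * \<tau>)" using tau by simp
    moreover have "(1 - \<tau>\<^sup>2) * (1 - 3 * \<tau>) = 1 - 3 * \<tau> - \<tau>\<^sup>2 + \<tau>\<^sup>2 * (3 * \<tau>)"
      by (simp add: algebra_simps)
    ultimately show "1 - 4 * \<tau> \<le> (1 - \<tau>\<^sup>2) * (1 - 3 * \<tau>)"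
      using tau_sq tau by linarith
  qed auto
  also have "\<dots> = (1 - \<tau>\<^sup>2) * ((1 - 3 * \<tau>) * n\<^sup>2)" by simp
  also have "\<dots> \<le> (1 - \<tau>\<^sup>2) * (\<Sum>u\<in>T. m u)"
    using m_sum_ge tau_sq tau by (intro mult_left_mono) auto
  also note w_sum_ge_m
  finally show ?thesis .
qed

lemma w_square_sum: "(\<Sum>x\<in>V. \<Sum>y\<in>V. c x y * (w T x y)\<^sup>2) \<le> (1 + \<tau>) * n\<^sup>2"
proof -
  have "(\<Sum>x\<in>V. \<Sum>y\<in>V. c x y * (w T x y)\<^sup>2) =
     (\<Sum>x\<in>V. \<Sum>y\<in>V. c x y * ((w T x y)\<^sup>2 - w T x y)) + (\<Sum>x\<in>V. \<Sum>y\<in>V. c x y * w T x y)"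
    by (simp add: sum.distrib[symmetric] algebra_simps)
  also have "\<dots> \<le> (1 + 2 * \<kappa>) * n\<^sup>2"
    using w_excess[OF T_sub] w_sum_le[OF T_sub] by (simp add: algebra_simps)
  also have "\<dots> \<le> (1 + \<tau>) * n\<^sup>2" using kappa tau by (intro mult_right_mono) auto
  finally show ?thesis .
qed

text \<open>Write \<open>(w - 1)^2 = (w^2 - w) - w + 1\<close>: the excess is small, the total of
  \<open>w\<close> is almost \<open>n^2\<close>, and there are at most \<open>n^2\<close>
  pairs.\<close>

lemma w_deviation: "(\<Sum>x\<in>V. \<Sum>y\<in>V. c x y * (w T x y - 1)\<^sup>2) \<le> 5 * \<tau> * n\<^sup>2"
proof -
  have "(\<Sum>x\<in>V. \<Sum>y\<in>V. c x y * (w T x y - 1)\<^sup>2) =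
     (\<Sum>x\<in>V. \<Sum>y\<in>V. c x y * ((w T x y)\<^sup>2 - w T x y)) - (\<Sum>x\<in>V. \<Sum>y\<in>V. c x y * w T x y)
      + (\<Sum>x\<in>V. \<Sum>y\<in>V. c x y)"
    by (simp add: sum.distrib[symmetric] sum_subtractf[symmetric] algebra_simps power2_eq_square)
  also have "\<dots> \<le> \<kappa> * n\<^sup>2 - (1 - 4 * \<tau>) * n\<^sup>2 + n\<^sup>2"
    using w_excess[OF T_sub] w_sum_ge c_sum by linarith
  also have "\<dots> = (\<kappa> + 4 * \<tau>) * n\<^sup>2" by (simp add: algebra_simps)
  also have "\<dots> \<le> 5 * \<tau> * n\<^sup>2" using kappa tau by (intro mult_right_mono) auto
  finally show ?thesis .
qed

text \<open>The entries of \<open>w\<close> on \<open>F\<close> are not controlled by the number of good copies of \<open>C\<^sub>4\<close>. They become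
  negligible once the few points with a large diagonal entry are discarded.\<close>

definition X where "X = {x \<in> V. w T x x \<le> 2 * \<theta> * n / L}"

lemma X_sub: "X \<subseteq> V" by (auto simp: X_def)
lemma finX: "finite X" using X_sub finV finite_subset by blast

text \<open>Markov's inequality for the trace of \<open>w T\<close>. The trace is the sum of
  \<open>d u / s u\<close> over \<open>T\<close>, and \<open>d u > L / \<tau>\<close> bounds it by
  \<open>2 * \<tau> * n^2 / L\<close>; then \<open>\<tau> = \<theta>^2\<close> fits the threshold in
  \<open>X\<close>.\<close>

lemma card_X_compl: "real (card (V - X)) \<le> \<theta> * n"
proof -
  have "real (card (V - X)) * (2 * \<theta> * n / L) = (\<Sum>x\<in>V - X. 2 * \<theta> * n / L)" by simp
  also have "\<dots> \<le> (\<Sum>x\<in>V - X. w T x x)" by (intro sum_mono) (auto simp: X_def)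
  also have "\<dots> \<le> (\<Sum>x\<in>V. w T x x)" using finV w_nonneg by (intro sum_mono2) auto
  also have "\<dots> = (\<Sum>u\<in>T. \<Sum>x\<in>V. a x u * a x u / s u)" unfolding w_def by (rule sum.swap)
  also have "\<dots> = (\<Sum>u\<in>T. d u / s u)" by (simp add: a01 d_def sum_divide_distrib)
  also have "\<dots> \<le> (\<Sum>u\<in>T. \<tau> / L * m u)"
  proof (intro sum_mono)
    fix u assume "u \<in> T"
    then have "1 \<le> \<tau> / L * d u" using tau L_ge by (simp add: T_def field_simps)
    then have "d u * 1 \<le> d u * (\<tau> / L * d u)" using d_nonneg by (intro mult_left_mono)
    then have "d u / s u \<le> d u * (\<tau> / L * d u) / s u" using s_ge by (intro divide_right_mono) auto
    then show "d u / s u \<le> \<tau> / L * m u" by (simp add: m_def power2_eq_square algebra_simps)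
  qed
  also have "\<dots> \<le> \<tau> / L * (2 * n\<^sup>2)"
  proof -
    have "(1 + 2 * \<tau>) * n\<^sup>2 \<le> 2 * n\<^sup>2" using tau by (intro mult_right_mono) auto
    then show ?thesis unfolding sum_distrib_left[symmetric]
      using m_sum_le tau L_ge by (intro mult_left_mono) auto
  qed
  also have "\<dots> = (\<theta> * n) * (2 * \<theta> * n / L)" by (simp add: \<tau>_def power2_eq_square)
  finally show ?thesis
    using theta n_pos L_ge by (subst (asm) mult_le_cancel_right_pos) auto
qed

lemma card_X: "X \<noteq> {}" "0 < real (card X)" "real (card X) \<le> n"
proof -
  have "real (card V) = real (card X) + real (card (V - X))"
    using card_Diff_subset[OF finX X_sub] card_mono[OF finV X_sub] by simp
  then have "real (card X) \<ge> (1 - \<theta>) * n" using card_X_compl by (simp add: n_def algebra_simps)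
  moreover have "(1 - \<theta>) * n > 0" using theta n_pos by simp
  ultimately show *: "0 < real (card X)" by simp
  then show "X \<noteq> {}" by auto
  show "real (card X) \<le> n" using card_mono[OF finV X_sub] by (simp add: n_def)
qed

lemma f_sum_le:
  assumes "Y \<subseteq> V"
  shows "(\<Sum>x\<in>Y. \<Sum>y\<in>Y. f x y) \<le> L\<^sup>2"
proof -
  have "(\<Sum>x\<in>Y. \<Sum>y\<in>Y. f x y) \<le> (\<Sum>x\<in>Y. e x)"
    unfolding e_def using assms finV f01 by (intro sum_mono sum_mono2) auto
  also have "\<dots> \<le> (\<Sum>x\<in>V. e x)" using assms finV e_nonneg by (intro sum_mono2) auto
  finally show ?thesis using L_ge by simp
qed

text \<open>For \<open>x\<close> in \<open>X\<close> the whole row is bounded by its diagonal entry,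
  hence by a multiple of \<open>n / L\<close>. As \<open>F\<close> has at most \<open>L^2\<close>
  ordered pairs, \<open>L\<close> cancels.\<close>

lemma w_F_sum: "(\<Sum>x\<in>X. \<Sum>y\<in>X. f x y * (w T x y)\<^sup>2) \<le> 4 * \<tau> * n\<^sup>2"
proof -
  have "(\<Sum>x\<in>X. \<Sum>y\<in>X. f x y * (w T x y)\<^sup>2) \<le> (\<Sum>x\<in>X. \<Sum>y\<in>X. f x y * (2 * \<theta> * n / L)\<^sup>2)"
  proof (intro sum_mono mult_left_mono power_mono)
    fix x y assume "x \<in> X"
    then show "w T x y \<le> 2 * \<theta> * n / L"
      using w_mono[OF T_sub, of x y] by (simp add: X_def)
  qed (use w_nonneg f01 in auto)
  also have "\<dots> = (\<Sum>x\<in>X. \<Sum>y\<in>X. f x y) * (2 * \<theta> * n / L)\<^sup>2" by (simp add: sum_distrib_right)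
  also have "\<dots> \<le> L\<^sup>2 * (2 * \<theta> * n / L)\<^sup>2" using f_sum_le[OF X_sub] by (intro mult_right_mono) auto
  also have "\<dots> = 4 * \<tau> * n\<^sup>2" using L_ge by (simp add: \<tau>_def power2_eq_square)
  finally show ?thesis .
qed

lemma sum2_mono_sets:
  fixes g :: "'a \<Rightarrow> 'a \<Rightarrow> real"
  assumes "A \<subseteq> V" "B \<subseteq> V" "\<And>x y. g x y \<ge> 0"
  shows "(\<Sum>x\<in>A. \<Sum>y\<in>B. g x y) \<le> (\<Sum>x\<in>V. \<Sum>y\<in>V. g x y)"
proof -
  have "(\<Sum>x\<in>A. \<Sum>y\<in>B. g x y) \<le> (\<Sum>x\<in>A. \<Sum>y\<in>V. g x y)"
    using assms finV by (intro sum_mono sum_mono2) auto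
  also have "\<dots> \<le> (\<Sum>x\<in>V. \<Sum>y\<in>V. g x y)"
    using assms finV by (intro sum_mono2 sum_nonneg) auto
  finally show ?thesis .
qed

lemma sum2_inner_ge:
  fixes g :: "'a \<Rightarrow> 'a \<Rightarrow> real"
  assumes "Y \<subseteq> V" "\<And>x y. g x y \<ge> 0"
  shows "(\<Sum>x\<in>V. \<Sum>y\<in>V. g x y) - (\<Sum>x\<in>V-Y. \<Sum>y\<in>V. g x y) - (\<Sum>x\<in>V. \<Sum>y\<in>V-Y. g x y)
    \<le> (\<Sum>x\<in>Y. \<Sum>y\<in>Y. g x y)"
proof -
  have "(\<Sum>x\<in>V. \<Sum>y\<in>V. g x y) = (\<Sum>x\<in>Y. \<Sum>y\<in>V. g x y) + (\<Sum>x\<in>V-Y. \<Sum>y\<in>V. g x y)"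
    using sum.subset_diff[OF assms(1) finV, of "\<lambda>x. \<Sum>y\<in>V. g x y"] by simp
  moreover have "(\<Sum>x\<in>Y. \<Sum>y\<in>V. g x y) = (\<Sum>x\<in>Y. \<Sum>y\<in>Y. g x y) + (\<Sum>x\<in>Y. \<Sum>y\<in>V-Y. g x y)"
    unfolding sum.distrib[symmetric] using sum.subset_diff[OF assms(1) finV]
    by (intro sum.cong refl) (simp add: add.commute)
  moreover have "(\<Sum>x\<in>Y. \<Sum>y\<in>V-Y. g x y) \<le> (\<Sum>x\<in>V. \<Sum>y\<in>V-Y. g x y)"
    using assms finV by (intro sum_mono2 sum_nonneg) auto
  ultimately show ?thesis by linarith
qed

lemma w_X_sum: "(\<Sum>x\<in>X. \<Sum>y\<in>X. w T x y) \<ge> (1 - 18 * \<theta>) * n\<^sup>2"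
proof -
  \<comment> \<open>A thin rectangle might carry much of \<open>w\<close>. Bounding each entry by a
    constant plus its squared deviation rules this out through \<open>w_deviation\<close>.\<close>
  have cw: "c x y * w T x y \<le> 2 + c x y * (w T x y - 1)\<^sup>2" for x y
  proof -
    have "w T x y \<le> 2 + (w T x y - 1)\<^sup>2"
      using zero_le_power2[of "w T x y - 3/2"] by (simp add: power2_eq_square algebra_simps)
    then show ?thesis by (auto simp: c_def)
  qed
  have loss: "(\<Sum>x\<in>A. \<Sum>y\<in>B. c x y * w T x y) \<le> (2 * \<theta> + 5 * \<tau>) * n\<^sup>2"
    if "A \<subseteq> V" "B \<subseteq> V" "real (card A) * real (card B) \<le> \<theta> * n * n" for A B
  proof -
    have "(\<Sum>x\<in>A. \<Sum>y\<in>B. c x y * w T x y) \<le> (\<Sum>x\<in>A. \<Sum>y\<in>B. 2 + c x y * (w T x y - 1)\<^sup>2)"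
      by (intro sum_mono cw)
    also have "\<dots> = 2 * (real (card A) * real (card B)) + (\<Sum>x\<in>A. \<Sum>y\<in>B. c x y * (w T x y - 1)\<^sup>2)"
      by (simp add: sum.distrib)
    also have "(\<Sum>x\<in>A. \<Sum>y\<in>B. c x y * (w T x y - 1)\<^sup>2) \<le> (\<Sum>x\<in>V. \<Sum>y\<in>V. c x y * (w T x y - 1)\<^sup>2)"
      using that c01 by (intro sum2_mono_sets) auto
    also have "\<dots> \<le> 5 * \<tau> * n\<^sup>2" by (rule w_deviation)
    finally show ?thesis using that(3) by (simp add: power2_eq_square algebra_simps)
  qed
  have k: "real (card (V - X)) * n \<le> \<theta> * n * n"
    using card_X_compl n_pos by (intro mult_right_mono) auto
  have "(\<Sum>x\<in>V-X. \<Sum>y\<in>V. c x y * w T x y) \<le> (2 * \<theta> + 5 * \<tau>) * n\<^sup>2"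
    using k by (intro loss) (auto simp: n_def)
  moreover have "(\<Sum>x\<in>V. \<Sum>y\<in>V-X. c x y * w T x y) \<le> (2 * \<theta> + 5 * \<tau>) * n\<^sup>2"
    using k by (intro loss) (auto simp: n_def mult.commute)
  ultimately have "(1 - 4 * \<tau>) * n\<^sup>2 - 2 * ((2 * \<theta> + 5 * \<tau>) * n\<^sup>2) \<le> (\<Sum>x\<in>X. \<Sum>y\<in>X. c x y * w T x y)"
    using sum2_inner_ge[OF X_sub, of "\<lambda>x y. c x y * w T x y"] w_sum_ge w_nonneg c01 by fastforce
  also have "\<dots> \<le> (\<Sum>x\<in>X. \<Sum>y\<in>X. w T x y)"
    using w_nonneg by (intro sum_mono) (auto simp: c_def)
  finally have "(1 - 4 * \<tau> - 2 * (2 * \<theta> + 5 * \<tau>)) * n\<^sup>2 \<le> (\<Sum>x\<in>X. \<Sum>y\<in>X. w T x y)"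
    by (simp add: algebra_simps)
  moreover have "(1 - 18 * \<theta>) * n\<^sup>2 \<le> (1 - 4 * \<tau> - 2 * (2 * \<theta> + 5 * \<tau>)) * n\<^sup>2"
    using tau theta by (intro mult_right_mono) auto
  ultimately show ?thesis by simp
qed

lemma w_X_square_sum: "(\<Sum>x\<in>X. \<Sum>y\<in>X. (w T x y)\<^sup>2) \<le> (1 + 5 * \<tau>) * n\<^sup>2"
proof -
  have "(\<Sum>x\<in>X. \<Sum>y\<in>X. (w T x y)\<^sup>2) =
    (\<Sum>x\<in>X. \<Sum>y\<in>X. c x y * (w T x y)\<^sup>2) + (\<Sum>x\<in>X. \<Sum>y\<in>X. f x y * (w T x y)\<^sup>2)"
    by (simp add: sum.distrib[symmetric] distrib_right[symmetric] c01)
  moreover have "(\<Sum>x\<in>X. \<Sum>y\<in>X. c x y * (w T x y)\<^sup>2) \<le> (\<Sum>x\<in>V. \<Sum>y\<in>V. c x y * (w T x y)\<^sup>2)"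
    using c01 X_sub by (intro sum2_mono_sets) auto
  ultimately have "(\<Sum>x\<in>X. \<Sum>y\<in>X. (w T x y)\<^sup>2) \<le> (1 + \<tau>) * n\<^sup>2 + 4 * \<tau> * n\<^sup>2"
    using w_square_sum w_F_sum by linarith
  then show ?thesis by (simp add: algebra_simps)
qed

section \<open>Codegrees of heavy vertices and non-edges between them\<close>

definition D where "D u = (\<Sum>x\<in>X. a x u)"

lemma D: "0 \<le> D u" "D u \<le> d u"
  unfolding D_def d_def using X_sub finV a01 by (auto intro: sum_nonneg sum_mono2)

lemma D_sum: "(\<Sum>u\<in>T. (D u)\<^sup>2 / s u) = (\<Sum>x\<in>X. \<Sum>y\<in>X. w T x y)"
proof -
  have "(\<Sum>x\<in>X. \<Sum>y\<in>X. w T x y) = (\<Sum>x\<in>X. \<Sum>u\<in>T. \<Sum>y\<in>X. a x u * a y u / s u)"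
    unfolding w_def by (intro sum.cong refl sum.swap)
  also have "\<dots> = (\<Sum>u\<in>T. \<Sum>x\<in>X. \<Sum>y\<in>X. a x u * a y u / s u)" by (rule sum.swap)
  also have "\<dots> = (\<Sum>u\<in>T. (D u)\<^sup>2 / s u)"
    by (simp add: D_def power2_eq_square sum_product sum_divide_distrib)
  finally show ?thesis by simp
qed

text \<open>Expanding the square gives pairs \<open>x, y\<close> of common neighbours of
  \<open>u, v\<close>. Non-edges \<open>x y\<close> are covered by \<open>good_weight\<close>; for
  \<open>x y\<close> in \<open>F\<close>, dropping the factor \<open>c u v\<close> leaves
  \<open>(w T x y)^2\<close>, which \<open>w_F_sum\<close> handles.\<close>

lemma codegree_nonedges:
  "(\<Sum>u\<in>T. \<Sum>v\<in>T. c u v / (s u * s v) * (\<Sum>x\<in>X. a x u * a x v)\<^sup>2) \<le> 5 * \<tau> * n\<^sup>2"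
proof -
  define g where "g x y = (\<Sum>u\<in>T. \<Sum>v\<in>T. (a x u * a y u) * (a x v * a y v) * c u v / (s u * s v))" for x y
  have g0: "g x y \<ge> 0" for x y unfolding g_def using a01 c01 s_ge(4)
    by (intro sum_nonneg divide_nonneg_nonneg mult_nonneg_nonneg) auto
  have gw: "g x y \<le> (w T x y)\<^sup>2" for x y
  proof -
    have "(w T x y)\<^sup>2 = (\<Sum>u\<in>T. \<Sum>v\<in>T. (a x u * a y u) * (a x v * a y v) / (s u * s v))"
      by (simp add: w_def power2_eq_square sum_product)
    then show ?thesis unfolding g_def using a01 c01 s_ge(4)
      by (auto intro!: sum_mono divide_right_mono mult_nonneg_nonneg mult_left_le)
  qed
  have "(\<Sum>x\<in>X. \<Sum>y\<in>X. g x y) = (\<Sum>u\<in>T. \<Sum>v\<in>T. \<Sum>x\<in>X. \<Sum>y\<in>X. (a x u * a y u) * (a x v * a y v) * c u v / (s u * s v))"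
    unfolding g_def by (rule sum_swap4)
  also have "\<dots> = (\<Sum>u\<in>T. \<Sum>v\<in>T. c u v / (s u * s v) * (\<Sum>x\<in>X. a x u * a x v)\<^sup>2)"
    by (intro sum.cong refl) (simp add: power2_eq_square sum_product sum_distrib_left algebra_simps)
  finally have "(\<Sum>u\<in>T. \<Sum>v\<in>T. c u v / (s u * s v) * (\<Sum>x\<in>X. a x u * a x v)\<^sup>2) = (\<Sum>x\<in>X. \<Sum>y\<in>X. g x y)" ..
  also have "\<dots> = (\<Sum>x\<in>X. \<Sum>y\<in>X. c x y * g x y) + (\<Sum>x\<in>X. \<Sum>y\<in>X. f x y * g x y)"
    by (simp add: sum.distrib[symmetric] distrib_right[symmetric] c01)
  also have "(\<Sum>x\<in>X. \<Sum>y\<in>X. c x y * g x y) \<le> (\<Sum>x\<in>V. \<Sum>y\<in>V. c x y * g x y)"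
    using g0 c01 X_sub by (intro sum2_mono_sets) auto
  also have "\<dots> \<le> \<kappa> * n\<^sup>2" using good_weight[OF T_sub] by (simp add: g_def)
  also have "(\<Sum>x\<in>X. \<Sum>y\<in>X. f x y * g x y) \<le> (\<Sum>x\<in>X. \<Sum>y\<in>X. f x y * (w T x y)\<^sup>2)"
    using gw f01 by (intro sum_mono mult_left_mono) auto
  also note w_F_sum
  finally have "(\<Sum>u\<in>T. \<Sum>v\<in>T. c u v / (s u * s v) * (\<Sum>x\<in>X. a x u * a x v)\<^sup>2) \<le> (\<kappa> + 4 * \<tau>) * n\<^sup>2"
    by (simp add: algebra_simps)
  also have "\<dots> \<le> 5 * \<tau> * n\<^sup>2" using kappa tau by (intro mult_right_mono) auto
  finally show ?thesis by simp
qed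

lemma theta_sq: "(1 - 18 * \<theta>)\<^sup>2 \<ge> 1 - 36 * \<theta>"
  using theta by (simp add: power2_eq_square algebra_simps)

text \<open>By \<open>gram_variance\<close> the codegree of \<open>u\<close> and \<open>v\<close> is
  close to \<open>D u * D v / N\<close> in weighted mean square. On non-edges it is also small, by
  \<open>codegree_nonedges\<close>, so \<open>D u * D v\<close> must be small there.\<close>

lemma D_nonedges:
  "(\<Sum>u\<in>T. \<Sum>v\<in>T. c u v * ((D u)\<^sup>2 / s u * ((D v)\<^sup>2 / s v))) \<le> 100 * \<theta> * n ^ 4"
proof -
  define N where "N = real (card X)"
  define b where "b u v = (\<Sum>x\<in>X. a x u * a x v)" for u v
  have N: "0 < N" "N \<le> n" using card_X by (auto simp: N_def)
  have wT: "w T x y = (\<Sum>u\<in>T. 1 / s u * a x u * a y u)" for x y by (simp add: w_def)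
  have "(\<Sum>u\<in>T. \<Sum>v\<in>T. 1 / s u * (1 / s v) * (b u v - D u * D v / N)\<^sup>2)
     \<le> (\<Sum>x\<in>X. \<Sum>y\<in>X. (w T x y)\<^sup>2) - (\<Sum>x\<in>X. \<Sum>y\<in>X. w T x y)\<^sup>2 / N\<^sup>2"
    unfolding b_def D_def N_def wT using s_ge(4) finX card_X(1)
    by (intro gram_variance) auto
  also have "\<dots> \<le> (1 + 5 * \<tau>) * n\<^sup>2 - (1 - 36 * \<theta>) * n\<^sup>2"
  proof -
    \<comment> \<open>Having \<open>N\<close> instead of the larger \<open>n\<close> in the
      denominator only increases the subtracted term.\<close>
    have "(1 - 36 * \<theta>) * n\<^sup>2 * N\<^sup>2 \<le> (1 - 36 * \<theta>) * n\<^sup>2 * n\<^sup>2"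
      using N theta by (intro mult_left_mono power_mono) auto
    also have "\<dots> \<le> (1 - 18 * \<theta>)\<^sup>2 * n\<^sup>2 * n\<^sup>2"
      using theta_sq by (intro mult_right_mono) auto
    also have "\<dots> = ((1 - 18 * \<theta>) * n\<^sup>2)\<^sup>2" by (simp add: power2_eq_square algebra_simps)
    also have "\<dots> \<le> (\<Sum>x\<in>X. \<Sum>y\<in>X. w T x y)\<^sup>2"
      using w_X_sum theta by (intro power_mono) auto
    finally have "(1 - 36 * \<theta>) * n\<^sup>2 \<le> (\<Sum>x\<in>X. \<Sum>y\<in>X. w T x y)\<^sup>2 / N\<^sup>2"
      using N by (simp add: field_simps)
    then show ?thesis using w_X_square_sum by linarith
  qed
  also have "\<dots> = (5 * \<tau> + 36 * \<theta>) * n\<^sup>2" by (simp add: algebra_simps)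
  finally have var: "(\<Sum>u\<in>T. \<Sum>v\<in>T. 1 / s u * (1 / s v) * (b u v - D u * D v / N)\<^sup>2) \<le> (5 * \<tau> + 36 * \<theta>) * n\<^sup>2" .
  have "(\<Sum>u\<in>T. \<Sum>v\<in>T. c u v * ((D u)\<^sup>2 / s u * ((D v)\<^sup>2 / s v))) \<le>
    (\<Sum>u\<in>T. \<Sum>v\<in>T. N\<^sup>2 * (2 * (1 / s u * (1 / s v) * (b u v - D u * D v / N)\<^sup>2)
       + 2 * (c u v / (s u * s v) * (b u v)\<^sup>2)))"
  proof (intro sum_mono)
    fix u v
    have "(D u * D v / N)\<^sup>2 \<le> 2 * (b u v - D u * D v / N)\<^sup>2 + 2 * (b u v)\<^sup>2"
      using zero_le_power2[of "2 * b u v - D u * D v / N"] by (simp add: power2_eq_square algebra_simps)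
    then have "N\<^sup>2 * (D u * D v / N)\<^sup>2 \<le> N\<^sup>2 * (2 * (b u v - D u * D v / N)\<^sup>2 + 2 * (b u v)\<^sup>2)"
      by (intro mult_left_mono) auto
    moreover have "N\<^sup>2 * (D u * D v / N)\<^sup>2 = (D u)\<^sup>2 * (D v)\<^sup>2"
      using N by (simp add: power_mult_distrib power_divide)
    ultimately have "(D u)\<^sup>2 * (D v)\<^sup>2 / (s u * s v) \<le>
        N\<^sup>2 * (2 * (b u v - D u * D v / N)\<^sup>2 + 2 * (b u v)\<^sup>2) / (s u * s v)"
      using s_ge(4) by (intro divide_right_mono) auto
    then have *: "(D u)\<^sup>2 / s u * ((D v)\<^sup>2 / s v) \<le>
        N\<^sup>2 * (2 * (1 / s u * (1 / s v) * (b u v - D u * D v / N)\<^sup>2) + 2 * (1 / (s u * s v) * (b u v)\<^sup>2))"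
      by (simp add: add_divide_distrib algebra_simps)
    show "c u v * ((D u)\<^sup>2 / s u * ((D v)\<^sup>2 / s v)) \<le>
        N\<^sup>2 * (2 * (1 / s u * (1 / s v) * (b u v - D u * D v / N)\<^sup>2) + 2 * (c u v / (s u * s v) * (b u v)\<^sup>2))"
      using * s_ge(4) by (cases "F u v") (auto simp: c_def)
  qed
  also have "\<dots> = N\<^sup>2 * (2 * (\<Sum>u\<in>T. \<Sum>v\<in>T. 1 / s u * (1 / s v) * (b u v - D u * D v / N)\<^sup>2)
     + 2 * (\<Sum>u\<in>T. \<Sum>v\<in>T. c u v / (s u * s v) * (b u v)\<^sup>2))"
    by (simp only: sum.distrib sum_distrib_left[symmetric])
  also have "\<dots> \<le> N\<^sup>2 * (2 * ((5 * \<tau> + 36 * \<theta>) * n\<^sup>2) + 2 * (5 * \<tau> * n\<^sup>2))"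
    using var codegree_nonedges by (intro mult_left_mono add_mono) (auto simp: b_def)
  also have "\<dots> = N\<^sup>2 * ((20 * \<tau> + 72 * \<theta>) * n\<^sup>2)" by (simp add: algebra_simps)
  also have "\<dots> \<le> n\<^sup>2 * ((100 * \<theta>) * n\<^sup>2)"
    using N tau theta by (intro mult_mono power_mono) auto
  also have "\<dots> = 100 * \<theta> * n ^ 4" by (simp add: power4_eq_xxxx power2_eq_square)
  finally show ?thesis .
qed

text \<open>Counting neighbours in \<open>X\<close> only lowers the mass from \<open>m u\<close> to
  \<open>p u\<close>. Both total masses are about \<open>n^2\<close>, so passing back costs at most
  the difference of their squares, of order \<open>\<theta> * n^4\<close>.\<close>

lemma m_nonedges: "(\<Sum>u\<in>T. \<Sum>v\<in>T. c u v * (m u * m v)) \<le> 150 * \<theta> * n ^ 4"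
proof -
  define p where "p u = (D u)\<^sup>2 / s u" for u
  have p: "0 \<le> p u" "p u \<le> m u" for u
    unfolding p_def m_def using D[of u] s_ge(4)[of u] by (auto intro!: divide_right_mono power_mono)
  have "c u v * (m u * m v) \<le> c u v * (p u * p v) + (m u * m v - p u * p v)" for u v
    using mult_mono[OF p(2)[of u] p(2)[of v] m_nonneg p(1)] by (auto simp: c_def)
  then have "(\<Sum>u\<in>T. \<Sum>v\<in>T. c u v * (m u * m v)) \<le>
      (\<Sum>u\<in>T. \<Sum>v\<in>T. c u v * (p u * p v) + (m u * m v - p u * p v))"
    by (intro sum_mono)
  also have "\<dots> = (\<Sum>u\<in>T. \<Sum>v\<in>T. c u v * (p u * p v)) + ((\<Sum>u\<in>T. m u)\<^sup>2 - (\<Sum>u\<in>T. p u)\<^sup>2)"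
    by (simp add: sum.distrib sum_subtractf power2_eq_square sum_product)
  also have "\<dots> \<le> 100 * \<theta> * n ^ 4 + (((1 + 2 * \<tau>) * n\<^sup>2)\<^sup>2 - ((1 - 18 * \<theta>) * n\<^sup>2)\<^sup>2)"
  proof (intro add_mono diff_mono power_mono)
    show "(1 - 18 * \<theta>) * n\<^sup>2 \<le> (\<Sum>u\<in>T. p u)" using w_X_sum by (simp add: p_def D_sum)
    show "(\<Sum>u\<in>T. \<Sum>v\<in>T. c u v * (p u * p v)) \<le> 100 * \<theta> * n ^ 4"
      using D_nonedges by (simp add: p_def)
  qed (use m_sum_le m_nonneg theta in \<open>auto intro: sum_nonneg\<close>)
  also have "\<dots> = (100 * \<theta> + (1 + 2 * \<tau>)\<^sup>2 - (1 - 18 * \<theta>)\<^sup>2) * n ^ 4"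
    by (simp add: power_mult_distrib algebra_simps power4_eq_xxxx power2_eq_square)
  also have "\<dots> \<le> 150 * \<theta> * n ^ 4"
  proof (intro mult_right_mono)
    have "(1 + 2 * \<tau>)\<^sup>2 = 1 + 4 * \<tau> + 4 * \<tau>\<^sup>2" by (simp add: power2_eq_square algebra_simps)
    then show "100 * \<theta> + (1 + 2 * \<tau>)\<^sup>2 - (1 - 18 * \<theta>)\<^sup>2 \<le> 150 * \<theta>"
      using theta_sq tau_sq tau theta by linarith
  qed (use n_pos in auto)
  finally show ?thesis .
qed

section \<open>From mass on edges to a near-clique\<close>

lemma s_T_lower: "\<mu>\<^sup>2 * (\<Sum>u\<in>T. s u) \<ge> (1 - 4 * \<tau>) * n\<^sup>2"
  using s_T_ge m_sum_le by (simp add: algebra_simps)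

lemma e_sum_ge: "(\<Sum>u\<in>V. e u) \<ge> (1 - \<psi>) * l\<^sup>2"
proof -
  have "\<mu>\<^sup>2 * ((1 - 4 * \<tau>) * l\<^sup>2) = (1 - 4 * \<tau>) * (\<mu>\<^sup>2 * l\<^sup>2)" by simp
  also have "\<dots> \<le> \<mu>\<^sup>2 * (\<Sum>u\<in>V. s u)"
    using s_T_lower mult_left_mono[OF s_T_le, of "\<mu>\<^sup>2"] by (simp add: mu)
  finally have "(1 - 4 * \<tau>) * l\<^sup>2 \<le> (\<Sum>u\<in>V. s u)" using mu by simp
  then have "(1 - 4 * \<tau> - \<kappa>) * l\<^sup>2 \<le> (\<Sum>u\<in>V. e u)" using s_sum by (simp add: algebra_simps)
  moreover have "(1 - \<psi>) * l\<^sup>2 \<le> (1 - 4 * \<tau> - \<kappa>) * l\<^sup>2"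
    using kappa tau theta by (intro mult_right_mono) auto
  ultimately show ?thesis by simp
qed

text \<open>Outside \<open>T\<close> little of \<open>s\<close> is left, since \<open>T\<close>
  carries nearly all of it. Inside \<open>B\<close>, \<open>\<mu>^2 * s u\<close> is at most twice
  \<open>m u\<close> plus twice the weighted square deviation of \<open>d u / s u\<close> from
  \<open>\<mu>\<close>, and both have small sums.\<close>

lemma small_m_imp_small_e:
  assumes B: "B \<subseteq> T" "(\<Sum>u\<in>B. m u) \<le> \<psi> * n\<^sup>2"
  shows "(\<Sum>u\<in>V - (T - B). e u) \<le> 3 * \<psi> * l\<^sup>2"
proof -
  have dev: "(\<Sum>u\<in>T. s u * (d u / s u - \<mu>)\<^sup>2) \<le> 5 * \<tau> * n\<^sup>2"
  proof -
    have "(\<Sum>u\<in>T. s u * (d u / s u - \<mu>)\<^sup>2) \<le> (1 + 2 * \<tau>) * n\<^sup>2 - 2 * (1 - \<tau>) * n\<^sup>2 + (1 + 2 * \<kappa>) * n\<^sup>2"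
      unfolding deviation_sum
      using m_sum_le mu_d_T_sum s_V_mu mult_left_mono[OF s_T_le, of "\<mu>\<^sup>2"] by simp
    also have "\<dots> = (4 * \<tau> + 2 * \<kappa>) * n\<^sup>2" by (simp add: algebra_simps)
    also have "\<dots> \<le> 5 * \<tau> * n\<^sup>2" using kappa tau by (intro mult_right_mono) auto
    finally show ?thesis .
  qed
  have "\<mu>\<^sup>2 * (\<Sum>u\<in>B. s u) \<le> (\<Sum>u\<in>B. 2 * m u + 2 * (s u * (d u / s u - \<mu>)\<^sup>2))"
    unfolding sum_distrib_left
  proof (intro sum_mono)
    fix u
    have "\<mu>\<^sup>2 \<le> 2 * (d u / s u)\<^sup>2 + 2 * (d u / s u - \<mu>)\<^sup>2"
      using zero_le_power2[of "2 * (d u / s u) - \<mu>"] by (simp add: power2_eq_square algebra_simps)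
    then have "s u * \<mu>\<^sup>2 \<le> s u * (2 * (d u / s u)\<^sup>2 + 2 * (d u / s u - \<mu>)\<^sup>2)"
      using s_ge(4) by (intro mult_left_mono)
    moreover have "s u * (d u / s u)\<^sup>2 = m u" using s_ge(3)[of u] by (simp add: m_def power2_eq_square)
    ultimately show "\<mu>\<^sup>2 * s u \<le> 2 * m u + 2 * (s u * (d u / s u - \<mu>)\<^sup>2)" by (simp add: algebra_simps)
  qed
  also have "\<dots> = 2 * (\<Sum>u\<in>B. m u) + 2 * (\<Sum>u\<in>B. s u * (d u / s u - \<mu>)\<^sup>2)"
    by (simp add: sum.distrib sum_distrib_left)
  also have "\<dots> \<le> 2 * (\<psi> * n\<^sup>2) + 2 * (5 * \<tau> * n\<^sup>2)"
  proof -
    have "(\<Sum>u\<in>B. s u * (d u / s u - \<mu>)\<^sup>2) \<le> (\<Sum>u\<in>T. s u * (d u / s u - \<mu>)\<^sup>2)"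
      using B finT s_ge(4) by (intro sum_mono2) auto
    then show ?thesis using dev B by simp
  qed
  finally have sB: "\<mu>\<^sup>2 * (\<Sum>u\<in>B. s u) \<le> (2 * \<psi> + 10 * \<tau>) * n\<^sup>2" by (simp add: algebra_simps)
  have "(\<Sum>u\<in>V. s u) = (\<Sum>u\<in>T - B. s u) + (\<Sum>u\<in>V - (T - B). s u)"
    using sum.subset_diff[of "T - B" V s] T_sub finV by (simp add: subset_iff)
  moreover have "(\<Sum>u\<in>T. s u) = (\<Sum>u\<in>B. s u) + (\<Sum>u\<in>T - B. s u)"
    using sum.subset_diff[of B T s] B finT by auto
  ultimately have eq: "(\<Sum>u\<in>V - (T - B). s u) = (\<Sum>u\<in>V. s u) - (\<Sum>u\<in>T. s u) + (\<Sum>u\<in>B. s u)" by simp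
  have "\<mu>\<^sup>2 * (\<Sum>u\<in>V - (T - B). s u) =
     \<mu>\<^sup>2 * (\<Sum>u\<in>V. s u) - \<mu>\<^sup>2 * (\<Sum>u\<in>T. s u) + \<mu>\<^sup>2 * (\<Sum>u\<in>B. s u)"
    unfolding eq by (simp add: algebra_simps)
  also have "\<dots> \<le> (1 + 2 * \<kappa>) * n\<^sup>2 - (1 - 4 * \<tau>) * n\<^sup>2 + (2 * \<psi> + 10 * \<tau>) * n\<^sup>2"
    using s_V_mu s_T_lower sB by linarith
  also have "\<dots> = (2 * \<kappa> + 14 * \<tau> + 2 * \<psi>) * n\<^sup>2" by (simp add: algebra_simps)
  also have "\<dots> \<le> 3 * \<psi> * n\<^sup>2"
    using kappa tau theta by (intro mult_right_mono) auto
  also have "\<dots> = \<mu>\<^sup>2 * (3 * \<psi> * l\<^sup>2)" by (simp add: mu(3)[symmetric])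
  finally have "(\<Sum>u\<in>V - (T - B). s u) \<le> 3 * \<psi> * l\<^sup>2" using mu by simp
  moreover have "(\<Sum>u\<in>V - (T - B). e u) \<le> (\<Sum>u\<in>V - (T - B). s u)"
    using s_ge by (intro sum_mono)
  ultimately show ?thesis by simp
qed

text \<open>Deleting the rows and the columns outside \<open>Y\<close> costs at most
  \<open>3 * \<psi> * l^2\<close> each, on top of the loss in \<open>e_sum_ge\<close>.\<close>

lemma f_inner_ge:
  assumes "Y \<subseteq> V" "(\<Sum>u\<in>V - Y. e u) \<le> 3 * \<psi> * l\<^sup>2"
  shows "(\<Sum>u\<in>Y. \<Sum>v\<in>Y. f u v) \<ge> (1 - 7 * \<psi>) * l\<^sup>2"
proof -
  have "(\<Sum>x\<in>V. \<Sum>y\<in>V-Y. f x y) = (\<Sum>y\<in>V-Y. \<Sum>x\<in>V. f y x)"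
    by (subst sum.swap) (simp add: f_commute)
  also have "\<dots> = (\<Sum>u\<in>V - Y. e u)" by (simp add: e_def)
  finally have "(\<Sum>u\<in>V. e u) - 2 * (\<Sum>u\<in>V - Y. e u) \<le> (\<Sum>u\<in>Y. \<Sum>v\<in>Y. f u v)"
    using sum2_inner_ge[OF assms(1), of f] f01 by (simp add: e_def)
  then have "(1 - \<psi>) * l\<^sup>2 - 2 * (3 * \<psi> * l\<^sup>2) \<le> (\<Sum>u\<in>Y. \<Sum>v\<in>Y. f u v)"
    using assms e_sum_ge by linarith
  then show ?thesis by (simp add: algebra_simps)
qed

text \<open>\<open>Z\<close> collects the heavy vertices joined by \<open>F\<close> to almost all
  mass; by Markov's inequality little mass is discarded, so most of \<open>F\<close> lies inside
  \<open>Z\<close>. For its size, the \<open>F\<close>-neighbourhood of each \<open>u\<close> in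
  \<open>Z\<close> also contains most of \<open>F\<close>, which forces \<open>e u\<close> to be
  almost \<open>l\<close>, while the degree sum is about \<open>l^2\<close>.\<close>

lemma near_clique:
  "\<exists>Z\<subseteq>V. real (card Z) \<le> (1 + 16 * \<psi>) * l \<and> (1 - 7 * \<psi>) * l\<^sup>2 \<le> (\<Sum>u\<in>Z. \<Sum>v\<in>Z. f u v)"
proof (intro exI conjI)
  define Z where "Z = {u \<in> T. (\<Sum>v\<in>T. c u v * m v) \<le> \<psi> * n\<^sup>2}"
  have ZT: "Z \<subseteq> T" by (auto simp: Z_def)
  show ZV: "Z \<subseteq> V" using ZT T_sub by blast
  have "(\<Sum>u\<in>T-Z. m u) * (\<psi> * n\<^sup>2) \<le> (\<Sum>u\<in>T-Z. m u * (\<Sum>v\<in>T. c u v * m v))"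
    unfolding sum_distrib_right using m_nonneg
    by (intro sum_mono mult_left_mono) (auto simp: Z_def)
  also have "\<dots> \<le> (\<Sum>u\<in>T. m u * (\<Sum>v\<in>T. c u v * m v))"
    using m_nonneg c01 finT by (intro sum_mono2 mult_nonneg_nonneg sum_nonneg) auto
  also have "\<dots> = (\<Sum>u\<in>T. \<Sum>v\<in>T. c u v * (m u * m v))"
    by (simp add: sum_distrib_left algebra_simps)
  also have "\<dots> \<le> 150 * \<theta> * n ^ 4" by (rule m_nonedges)
  \<comment> \<open>The constant 150 in \<open>\<theta>\<close> is chosen to produce this
    square.\<close>
  also have "\<dots> = (\<psi> * n\<^sup>2) * (\<psi> * n\<^sup>2)" unfolding theta(3) by (simp add: power4_eq_xxxx power2_eq_square)
  finally have "(\<Sum>u\<in>T-Z. m u) \<le> \<psi> * n\<^sup>2"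
    using psi n_pos by (subst (asm) mult_le_cancel_right_pos) auto
  then have "(\<Sum>u\<in>V - (T - (T - Z)). e u) \<le> 3 * \<psi> * l\<^sup>2"
    by (intro small_m_imp_small_e) auto
  moreover have "T - (T - Z) = Z" using ZT by auto
  ultimately show "(1 - 7 * \<psi>) * l\<^sup>2 \<le> (\<Sum>u\<in>Z. \<Sum>v\<in>Z. f u v)"
    by (intro f_inner_ge ZV) simp
  have eZ: "e u \<ge> (1 - 7 * \<psi>) * l" if u: "u \<in> Z" for u
  proof -
    define Y where "Y = {v \<in> V. F u v}"
    define B where "B = {v \<in> T. \<not> F u v}"
    have YV: "Y \<subseteq> V" by (auto simp: Y_def)
    have eY: "e u = real (card Y)"
      unfolding e_def f_def Y_def using finV by (simp add: Int_def)
    have "(\<Sum>v\<in>B. m v) = (\<Sum>v\<in>T. c u v * m v)"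
      unfolding B_def sum.inter_filter[OF finT] by (intro sum.cong refl) (simp add: c_def)
    then have "(\<Sum>v\<in>V - (T - B). e v) \<le> 3 * \<psi> * l\<^sup>2"
      using u by (intro small_m_imp_small_e) (auto simp: B_def Z_def)
    moreover have "(\<Sum>v\<in>V - Y. e v) \<le> (\<Sum>v\<in>V - (T - B). e v)"
      using finV e_nonneg by (intro sum_mono2) (auto simp: Y_def B_def)
    ultimately have "(1 - 7 * \<psi>) * l\<^sup>2 \<le> (\<Sum>x\<in>Y. \<Sum>y\<in>Y. f x y)"
      by (intro f_inner_ge YV) simp
    also have "\<dots> \<le> (\<Sum>x\<in>Y. \<Sum>y\<in>Y. 1)" using f01 by (intro sum_mono)
    also have "\<dots> = (e u)\<^sup>2" by (simp add: eY power2_eq_square)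
    finally have "(1 - 7 * \<psi>) * l\<^sup>2 \<le> (e u)\<^sup>2" .
    moreover have "((1 - 7 * \<psi>) * l)\<^sup>2 \<le> (1 - 7 * \<psi>) * l\<^sup>2"
      unfolding power_mult_distrib using psi
      by (intro mult_right_mono) (auto simp: power2_eq_square mult_left_le)
    ultimately have "((1 - 7 * \<psi>) * l)\<^sup>2 \<le> (e u)\<^sup>2" by simp
    then show ?thesis using e_nonneg by (rule power2_le_imp_le)
  qed
  have "real (card Z) * ((1 - 7 * \<psi>) * l) = (\<Sum>u\<in>Z. (1 - 7 * \<psi>) * l)" by simp
  also have "\<dots> \<le> (\<Sum>u\<in>Z. e u)" by (intro sum_mono eZ)
  also have "\<dots> \<le> (\<Sum>u\<in>V. e u)" using ZV finV e_nonneg by (intro sum_mono2) auto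
  also have "\<dots> \<le> (1 + \<psi>) * l\<^sup>2"
  proof -
    have "(1 + \<kappa>) * l\<^sup>2 \<le> (1 + \<psi>) * l\<^sup>2" using kappa tau theta by (intro mult_right_mono) auto
    then show ?thesis using e_sum by simp
  qed
  also have "\<dots> \<le> ((1 + 16 * \<psi>) * (1 - 7 * \<psi>)) * l\<^sup>2"
  proof (intro mult_right_mono)
    have "\<psi> * (112 * \<psi>) \<le> \<psi> * 8" using psi by (intro mult_left_mono) auto
    then show "1 + \<psi> \<le> (1 + 16 * \<psi>) * (1 - 7 * \<psi>)" by (simp add: algebra_simps)
  qed auto
  also have "\<dots> = ((1 + 16 * \<psi>) * l) * ((1 - 7 * \<psi>) * l)" by (simp add: power2_eq_square)
  finally show "real (card Z) \<le> (1 + 16 * \<psi>) * l"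
    using psi l_pos by (subst (asm) mult_le_cancel_right_pos) auto
qed

lemma l_le_n: "l \<le> n"
proof -
  have "\<tau> * n \<le> 1 * n" using tau n_pos by (intro mult_right_mono) auto
  then show ?thesis using L_le L_ge by simp
qed

end

section \<open>Good copies of the 4-cycle as quadruples of vertices\<close>

lemma good_tuples_le:
  fixes n :: nat
  assumes P: "pregraph n M E"
  defines "V \<equiv> {..<n}"
    and "F \<equiv> \<lambda>u v. u = v \<or> {u, v} \<in> E"
    and "adj \<equiv> \<lambda>x u. {x, u} \<in> M"
  shows "(\<Sum>x\<in>V. \<Sum>y\<in>V. \<Sum>u\<in>V. \<Sum>v\<in>V. of_bool (\<not> F x y) * of_bool (\<not> F u v) *
      (of_bool (adj x u) * of_bool (adj y u) * (of_bool (adj x v) * of_bool (adj y v))))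
    \<le> 256 * real (card (good_C4_copies n M E))"
proof -
  define good where "good = good_C4_copies n M E"
  define Q where "Q = {(x, y, u, v) \<in> V \<times> V \<times> V \<times> V. \<not> F x y \<and> \<not> F u v \<and> adj x u \<and> adj y u \<and> adj x v \<and> adj y v}"
  \<comment> \<open>A copy accounts only for quadruples of its own four vertices, at most
    \<open>4^4 = 256\<close>.\<close>
  define B where "B H = \<Union>H \<times> \<Union>H \<times> \<Union>H \<times> \<Union>H" for H :: "nat set set"
  have "(\<Sum>x\<in>V. \<Sum>y\<in>V. \<Sum>u\<in>V. \<Sum>v\<in>V. of_bool (\<not> F x y) * of_bool (\<not> F u v) *
      (of_bool (adj x u) * of_bool (adj y u) * (of_bool (adj x v) * of_bool (adj y v))))
    = (\<Sum>(x, y, u, v)\<in>V \<times> V \<times> V \<times> V. of_bool (\<not> F x y \<and> \<not> F u v \<and> adj x u \<and> adj y u \<and> adj x v \<and> adj y v) :: real)"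
    by (simp add: sum.cartesian_product[symmetric] of_bool_conj mult.assoc)
  also have "\<dots> = (\<Sum>z\<in>V \<times> V \<times> V \<times> V. of_bool (z \<in> Q))"
    by (intro sum.cong refl) (auto simp: Q_def)
  also have "\<dots> = real (card Q)"
  proof -
    have "finite (V \<times> V \<times> V \<times> V)" by (simp add: V_def)
    moreover have "V \<times> V \<times> V \<times> V \<inter> {z. z \<in> Q} = Q" by (auto simp: Q_def)
    ultimately show ?thesis by simp
  qed
  also have "card Q \<le> 256 * card good"
  proof -
    have fin: "finite good"
    proof (rule finite_subset)
      show "good \<subseteq> Pow (Pow V)"
        by (auto simp: good_def good_C4_copies_def C4_copies_def V_def)
      show "finite (Pow (Pow V))" by (simp add: V_def)
    qed
    have four: "card (B H) \<le> 256" "finite (B H)" if H: "H \<in> good" for H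
    proof -
      obtain a b c d where "H = {{a, b}, {b, c}, {c, d}, {d, a}}"
        using H by (auto simp: good_def good_C4_copies_def C4_copies_def)
      then have U: "\<Union>H = set [a, b, c, d]" by auto
      then have "card (\<Union>H) \<le> 4" using card_length[of "[a, b, c, d]"] by simp
      then have "card (\<Union>H) ^ 4 \<le> 4 ^ 4" by (intro power_mono) auto
      then show "card (B H) \<le> 256"
        by (simp add: B_def card_cartesian_product power4_eq_xxxx mult.assoc)
      show "finite (B H)" by (simp add: B_def U)
    qed
    have "Q \<subseteq> (\<Union>H\<in>good. B H)"
    proof
      fix z assume "z \<in> Q"
      then obtain x y u v where z: "z = (x, y, u, v)"
        and xyuv: "x < n" "y < n" "u < n" "v < n" "x \<noteq> y" "u \<noteq> v" "{x, y} \<notin> E" "{u, v} \<notin> E"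
          "{x, u} \<in> M" "{y, u} \<in> M" "{x, v} \<in> M" "{y, v} \<in> M"
        by (auto simp: Q_def V_def F_def adj_def)
      have M: "M \<subseteq> [{..<n}]\<^bsup>2\<^esup>" "M \<inter> E = {}" using P by (auto simp: pregraph_def)
      have ne: "p \<noteq> q" if "{p, q} \<in> M" for p q
        using subsetD[OF M(1) that] by (auto simp: nsets_def)
      have notE: "{p, q} \<notin> E" "{q, p} \<notin> E" if "{p, q} \<in> M" for p q
        using that M(2) by (auto simp: insert_commute)
      \<comment> \<open>The cycle visits \<open>x, u, y, v\<close> in this order: the diagonals
        \<open>x y\<close> and \<open>u v\<close> avoid \<open>E\<close> because they avoid
        \<open>F\<close>, and the sides avoid \<open>E\<close> because they lie in
        \<open>M\<close>.\<close>
      define H where "H = {{x, u}, {u, y}, {y, v}, {v, x}}"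
      have UH: "\<Union>H = {x, u, y, v}" by (auto simp: H_def)
      have "H \<in> good"
        unfolding good_def good_C4_copies_def
      proof (intro CollectI conjI)
        have "distinct [x, u, y, v]" using xyuv ne[OF xyuv(9)] ne[OF xyuv(10)] ne[OF xyuv(11)] ne[OF xyuv(12)] by auto
        then show "H \<in> C4_copies n" unfolding C4_copies_def H_def using xyuv(1-4) by blast
        show "H \<subseteq> M" using xyuv by (auto simp: H_def insert_commute)
        show "indep (\<Union>H) E"
          unfolding UH using xyuv(5-8) notE[OF xyuv(9)] notE[OF xyuv(10)] notE[OF xyuv(11)] notE[OF xyuv(12)]
          by (auto simp: indep_def insert_commute)
      qed
      moreover have "z \<in> B H" by (simp add: z B_def UH)
      ultimately show "z \<in> (\<Union>H\<in>good. B H)" by blast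
    qed
    then have "card Q \<le> card (\<Union>H\<in>good. B H)" using fin four by (intro card_mono) auto
    also have "\<dots> \<le> (\<Sum>H\<in>good. card (B H))" by (rule card_UN_le[OF fin])
    also have "\<dots> \<le> (\<Sum>H\<in>good. 256)" by (intro sum_mono four)
    finally show ?thesis by simp
  qed
  finally show ?thesis by (simp add: good_def)
qed

section \<open>Editing a near-clique into a clique on exactly \<open>l\<close> vertices\<close>

lemma real_choose_two: "2 * real (k choose 2) = (real k)\<^sup>2 - real k"
proof (induction k)
  case (Suc k)
  have "Suc k choose 2 = k + (k choose 2)" by (simp add: numeral_2_eq_2)
  with Suc show ?case by (simp add: power2_eq_square algebra_simps)
qed simp

text \<open>\<open>Z\<close> is padded or cut to a set \<open>U\<close> of \<open>l\<close>
  vertices. Both \<open>E\<close> and the clique on \<open>U\<close> have at most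
  \<open>l choose 2\<close> edges, so a large intersection bounds deletions and additions
  alike.\<close>

lemma near_clique_imp_close:
  fixes n l :: nat and \<epsilon> \<psi> :: real
  assumes E: "E \<subseteq> [{..<n}]\<^bsup>2\<^esup>" "card E \<le> l choose 2"
    and psi: "0 < \<psi>" "\<psi> \<le> 1/100" "300 * \<psi> \<le> \<epsilon>"
    and l: "l \<le> n" "1 \<le> \<psi> * real l"
    and Z: "Z \<subseteq> {..<n}" "real (card Z) \<le> (1 + 16 * \<psi>) * real l"
      "(1 - 7 * \<psi>) * (real l)\<^sup>2 \<le> (\<Sum>u\<in>Z. \<Sum>v\<in>Z. of_bool (u = v \<or> {u, v} \<in> E))"
  shows "close_to_complete \<epsilon> l n E"
proof -
  define z where "z = real (card Z)"
  have finZ: "finite Z" using Z finite_subset by blast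
  have finE: "finite E" using E finite_imp_finite_nsets[of "{..<n}" 2] finite_subset by blast
  have "of_bool (u = v \<or> {u, v} \<in> E) = of_bool (u = v) + (of_bool ({u, v} \<in> E \<inter> [Z]\<^bsup>2\<^esup>) :: real)"
    if "u \<in> Z" "v \<in> Z" for u v
  proof (cases "u = v")
    case True
    have "{u, v} \<notin> [Z]\<^bsup>2\<^esup>" using True by (simp add: nsets_def)
    then show ?thesis using True by auto
  next
    case False
    then have "{u, v} \<in> [Z]\<^bsup>2\<^esup>" using that by (simp add: nsets_def)
    then show ?thesis using False by auto
  qed
  then have "(\<Sum>u\<in>Z. \<Sum>v\<in>Z. of_bool (u = v \<or> {u, v} \<in> E)) =
      (\<Sum>u\<in>Z. \<Sum>v\<in>Z. of_bool (u = v) + of_bool ({u, v} \<in> E \<inter> [Z]\<^bsup>2\<^esup>) :: real)"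
    by (intro sum.cong refl) auto
  also have "\<dots> = (\<Sum>u\<in>Z. \<Sum>v\<in>Z. of_bool (u = v)) + 2 * real (card (E \<inter> [Z]\<^bsup>2\<^esup>))"
    unfolding sum.distrib by (subst sum_of_bool_doubleton[OF finZ]) auto
  also have "(\<Sum>u\<in>Z. \<Sum>v\<in>Z. of_bool (u = v)) = z"
    using finZ by (simp add: of_bool_def z_def)
  finally have EZ: "(1 - 7 * \<psi>) * (real l)\<^sup>2 - z \<le> 2 * real (card (E \<inter> [Z]\<^bsup>2\<^esup>))"
    using Z(3) by simp
  \<comment> \<open>The diagonal of \<open>Z\<close> is of lower order because
    \<open>1 \<le> \<psi> * l\<close>.\<close>
  have zl: "z \<le> 2 * \<psi> * (real l)\<^sup>2"
  proof -
    have "z \<le> 2 * real l"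
      using Z(2) mult_right_mono[of "1 + 16 * \<psi>" 2 "real l"] psi by (simp add: z_def)
    also have "\<dots> \<le> 2 * real l * (\<psi> * real l)" using l by (simp add: mult_le_cancel_left1)
    finally show ?thesis by (simp add: power2_eq_square algebra_simps)
  qed
  have "\<exists>U. U \<subseteq> {..<n} \<and> card U = l \<and> (1 - 60 * \<psi>) * (real l)\<^sup>2 \<le> 2 * real (card (E \<inter> [U]\<^bsup>2\<^esup>))"
  proof (cases "card Z \<le> l")
    case True
    then obtain U where U: "Z \<subseteq> U" "U \<subseteq> {..<n}" "card U = l"
      using exists_subset_between[of Z l "{..<n}"] Z(1) l by auto
    have "card (E \<inter> [Z]\<^bsup>2\<^esup>) \<le> card (E \<inter> [U]\<^bsup>2\<^esup>)"
      using nsets_mono[OF U(1)] finE by (intro card_mono) auto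
    then have "(1 - 7 * \<psi>) * (real l)\<^sup>2 - 2 * \<psi> * (real l)\<^sup>2 \<le> 2 * real (card (E \<inter> [U]\<^bsup>2\<^esup>))"
      using EZ zl by linarith
    moreover have "(1 - 60 * \<psi>) * (real l)\<^sup>2 \<le> (1 - 9 * \<psi>) * (real l)\<^sup>2"
      using psi by (intro mult_right_mono) auto
    ultimately show ?thesis using U by (intro exI[of _ U]) (simp add: algebra_simps)
  next
    case False
    then obtain U where U: "U \<subseteq> Z" "card U = l"
      using obtain_subset_with_card_n[of l Z] by auto
    \<comment> \<open>Cutting \<open>Z\<close> down to \<open>U\<close> loses at most the pairs of
      \<open>Z\<close> not inside \<open>U\<close>, at most \<open>(z^2 - l^2) / 2\<close> in
      number.\<close>
    have "card (E \<inter> [Z]\<^bsup>2\<^esup>) \<le> card ((E \<inter> [U]\<^bsup>2\<^esup>) \<union> ([Z]\<^bsup>2\<^esup> - [U]\<^bsup>2\<^esup>))"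
      using finZ finE finite_imp_finite_nsets[of Z 2] by (intro card_mono) auto
    also have "\<dots> \<le> card (E \<inter> [U]\<^bsup>2\<^esup>) + card ([Z]\<^bsup>2\<^esup> - [U]\<^bsup>2\<^esup>)" by (rule card_Un_le)
    also have "card ([Z]\<^bsup>2\<^esup> - [U]\<^bsup>2\<^esup>) = (card Z choose 2) - (l choose 2)"
      using nsets_mono[OF U(1), of 2] U finZ finite_subset[OF U(1) finZ]
      by (subst card_Diff_subset) (auto simp: card_nsets finite_imp_finite_nsets)
    finally have "real (card (E \<inter> [Z]\<^bsup>2\<^esup>)) \<le> real (card (E \<inter> [U]\<^bsup>2\<^esup>)) + (real (card Z choose 2) - real (l choose 2))"
      using binomial_right_mono[of l "card Z" 2] False by simp
    then have "2 * real (card (E \<inter> [Z]\<^bsup>2\<^esup>)) \<le> 2 * real (card (E \<inter> [U]\<^bsup>2\<^esup>)) + (z\<^sup>2 - z - ((real l)\<^sup>2 - real l))"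
      using real_choose_two[of "card Z"] real_choose_two[of l] by (simp add: z_def)
    moreover have "z \<ge> real l" using False by (simp add: z_def)
    moreover have "z\<^sup>2 \<le> (1 + 48 * \<psi>) * (real l)\<^sup>2"
    proof -
      have "z\<^sup>2 \<le> ((1 + 16 * \<psi>) * real l)\<^sup>2" using Z(2) by (intro power_mono) (auto simp: z_def)
      also have "\<dots> = (1 + 16 * \<psi>)\<^sup>2 * (real l)\<^sup>2" by (simp add: power_mult_distrib)
      also have "\<dots> \<le> (1 + 48 * \<psi>) * (real l)\<^sup>2"
      proof (intro mult_right_mono)
        have "\<psi> * (256 * \<psi>) \<le> \<psi> * 16" using psi by (intro mult_left_mono) auto
        then show "(1 + 16 * \<psi>)\<^sup>2 \<le> 1 + 48 * \<psi>" by (simp add: power2_eq_square algebra_simps)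
      qed auto
      finally show ?thesis .
    qed
    ultimately have "(1 - 7 * \<psi>) * (real l)\<^sup>2 - 2 * \<psi> * (real l)\<^sup>2 - ((1 + 48 * \<psi>) * (real l)\<^sup>2 - (real l)\<^sup>2)
        \<le> 2 * real (card (E \<inter> [U]\<^bsup>2\<^esup>))"
      using EZ zl by linarith
    moreover have "(1 - 60 * \<psi>) * (real l)\<^sup>2 \<le> (1 - 57 * \<psi>) * (real l)\<^sup>2"
      using psi by (intro mult_right_mono) auto
    ultimately show ?thesis using U Z(1) by (intro exI[of _ U]) (auto simp: algebra_simps)
  qed
  then obtain U where U: "U \<subseteq> {..<n}" "card U = l"
    "(1 - 60 * \<psi>) * (real l)\<^sup>2 \<le> 2 * real (card (E \<inter> [U]\<^bsup>2\<^esup>))" by blast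
  have finU: "finite U" using U finite_subset by blast
  have finU2: "finite ([U]\<^bsup>2\<^esup>)" using finU by (rule finite_imp_finite_nsets)
  show ?thesis unfolding close_to_complete_def
  proof (intro exI conjI)
    show "U \<subseteq> {..<n}" "card U = l" by fact+
    show "E - [U]\<^bsup>2\<^esup> \<subseteq> E" by blast
    show "[U]\<^bsup>2\<^esup> - E \<subseteq> [{..<n}]\<^bsup>2\<^esup> - E" using nsets_mono[OF U(1)] by blast
    show "(E - (E - [U]\<^bsup>2\<^esup>)) \<union> ([U]\<^bsup>2\<^esup> - E) = [U]\<^bsup>2\<^esup>" by blast
    define k where "k = real (card (E \<inter> [U]\<^bsup>2\<^esup>))"
    have "real (card (E - [U]\<^bsup>2\<^esup>)) = real (card E) - k"
      using finE card_mono[of E "E \<inter> [U]\<^bsup>2\<^esup>"] by (subst card_Diff_subset_Int) (auto simp: k_def)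
    moreover have "real (card ([U]\<^bsup>2\<^esup> - E)) = real (l choose 2) - k"
      using finU2 finE card_mono[of "[U]\<^bsup>2\<^esup>" "[U]\<^bsup>2\<^esup> \<inter> E"]
      by (subst card_Diff_subset_Int) (auto simp: k_def card_nsets U Int_commute)
    ultimately have "real (card (E - [U]\<^bsup>2\<^esup>) + card ([U]\<^bsup>2\<^esup> - E)) \<le> 2 * real (l choose 2) - 2 * k"
      using E(2) by simp
    also have "\<dots> \<le> 60 * \<psi> * (real l)\<^sup>2"
      using U(3) real_choose_two[of l] by (simp add: k_def algebra_simps)
    also have "\<dots> \<le> 75 * \<psi> * (real l)\<^sup>2" using psi by (intro mult_right_mono) auto
    also have "\<dots> \<le> 300 * \<psi> * real (l choose 2)"
    proof -
      \<comment> \<open>In particular \<open>l \<ge> 2\<close>, which gives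
        \<open>l^2 \<le> 4 * (l choose 2)\<close>.\<close>
      have "1 \<le> 1/100 * real l" using l(2) psi mult_right_mono[of \<psi> "1/100" "real l"] by simp
      then have "2 * real l \<le> real l * real l" by (intro mult_right_mono) auto
      then have "(real l)\<^sup>2 \<le> 4 * real (l choose 2)"
        using real_choose_two[of l] by (simp add: power2_eq_square)
      then have "75 * \<psi> * (real l)\<^sup>2 \<le> 75 * \<psi> * (4 * real (l choose 2))"
        using psi by (intro mult_left_mono) auto
      then show ?thesis by simp
    qed
    also have "\<dots> \<le> \<epsilon> * real (l choose 2)" using psi by (intro mult_right_mono) auto
    finally show "real (card (E - [U]\<^bsup>2\<^esup>) + card ([U]\<^bsup>2\<^esup> - E)) \<le> \<epsilon> * real (l choose 2)" .
  qed
qed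

section \<open>Assembly and choice of the constants\<close>

lemma close_or_many_good_C4:
  fixes n l :: nat and \<epsilon> \<psi> \<kappa> :: real
  assumes psi: "0 < \<psi>" "\<psi> \<le> 1/100" "300 * \<psi> \<le> \<epsilon>"
    and kappa: "\<kappa> = (\<psi>\<^sup>2 / 150) ^ 4 / 10"
    and n: "n \<ge> 1" and l: "real l \<ge> 1 / \<kappa> * sqrt (real n)"
    and P: "pregraph n M E"
    and E: "card E \<le> l choose 2"
    and M: "real (card M) \<ge> (1 - \<kappa>) * real l * real n"
    and few: "real (card (good_C4_copies n M E)) < \<kappa> ^ 3 / 256 * real l ^ 4"
  shows "close_to_complete \<epsilon> l n E"
proof -
  define V where "V = {..<n}"
  define F where "F = (\<lambda>u v. u = v \<or> {u, v} \<in> E)"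
  define adj where "adj = (\<lambda>x u. {x, u} \<in> M)"
  have ME: "M \<subseteq> [V]\<^bsup>2\<^esup>" "E \<subseteq> [V]\<^bsup>2\<^esup>" using P by (auto simp: pregraph_def V_def)
  have finV: "finite V" by (simp add: V_def)
  have k: "0 < \<kappa>" "\<kappa> \<le> \<psi>" "\<kappa> \<le> 1"
  proof -
    define \<theta> where "\<theta> = \<psi>\<^sup>2 / 150"
    have "\<psi>\<^sup>2 \<le> \<psi> * 1" unfolding power2_eq_square using psi by (intro mult_left_mono) auto
    then have th: "0 < \<theta>" "\<theta> \<le> \<psi>" "\<theta> \<le> 1" using psi by (auto simp: \<theta>_def)
    have "\<theta> ^ 4 \<le> \<theta> ^ 1" using th by (intro power_decreasing) auto
    moreover have "\<theta> ^ 4 > 0" using th by simp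
    ultimately show "0 < \<kappa>" "\<kappa> \<le> \<psi>" "\<kappa> \<le> 1"
      using th psi by (auto simp: kappa \<theta>_def[symmetric])
  qed
  have lk: "\<kappa> * real l \<ge> sqrt (real n)" using l k by (simp add: field_simps)
  \<comment> \<open>The \<open>n\<close> diagonal pairs of \<open>F\<close> must fit into the error
    \<open>\<kappa> * l^2\<close> of \<open>e_sum\<close>; the factor \<open>1 / \<kappa>\<close>
    before \<open>sqrt n\<close> secures this.\<close>
  have n_le: "real n \<le> \<kappa> * (real l)\<^sup>2"
  proof -
    have "real n = (sqrt (real n))\<^sup>2" by simp
    also have "\<dots> \<le> (\<kappa> * real l)\<^sup>2" using lk by (intro power_mono) auto
    also have "\<dots> = \<kappa> * (\<kappa> * (real l)\<^sup>2)" by (simp add: power2_eq_square)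
    also have "\<dots> \<le> \<kappa> * (1 * (real l)\<^sup>2)" using k by (intro mult_left_mono mult_right_mono) auto
    finally show ?thesis by simp
  qed
  have l1: "1 \<le> \<psi> * real l"
  proof -
    have "1 \<le> sqrt (real n)" using n by simp
    also note lk
    also have "\<kappa> * real l \<le> \<psi> * real l" using k by (intro mult_right_mono) auto
    finally show ?thesis .
  qed
  have lpos: "0 < real l" using l1 by (cases "l = 0") auto
  have Fsum: "(\<Sum>u\<in>V. \<Sum>v\<in>V. of_bool (F u v)) = real n + 2 * real (card E)"
  proof -
    have "{u, u} \<notin> E" for u using ME by (auto simp: nsets_def)
    then have "(\<Sum>u\<in>V. \<Sum>v\<in>V. of_bool (F u v)) = (\<Sum>u\<in>V. \<Sum>v\<in>V. of_bool (u = v) + of_bool ({u, v} \<in> E) :: real)"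
      by (intro sum.cong refl) (auto simp: F_def)
    also have "\<dots> = real n + 2 * real (card E)"
      unfolding sum.distrib sum_of_bool_doubleton[OF finV ME(2)]
      by (simp add: of_bool_def V_def)
    finally show ?thesis .
  qed
  have dense: "dense_pregraph V adj F (real l) \<psi>"
  proof
    show "finite V" by (rule finV)
    show "V \<noteq> {}" using n by (auto simp: V_def lessThan_empty_iff)
    show "F u v \<longleftrightarrow> F v u" for u v by (auto simp: F_def insert_commute)
    show "0 < real l" "0 < \<psi>" "\<psi> \<le> 1/100" by fact+
    show "(\<Sum>u\<in>V. \<Sum>v\<in>V. of_bool (F u v)) \<le> (1 + (\<psi>\<^sup>2 / 150) ^ 4 / 10) * (real l)\<^sup>2"
    proof -
      have "2 * real (card E) \<le> (real l)\<^sup>2" using E real_choose_two[of l] by simp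
      then show ?thesis unfolding Fsum kappa[symmetric] using n_le by (simp add: algebra_simps)
    qed
    have Msum: "(\<Sum>u\<in>V. \<Sum>x\<in>V. of_bool (adj x u)) = 2 * real (card M)"
      using sum_of_bool_doubleton[OF finV ME(1)] by (simp add: adj_def insert_commute)
    have "card V = n" by (simp add: V_def)
    then show "2 * (1 - (\<psi>\<^sup>2 / 150) ^ 4 / 10) * real l * real (card V) \<le> (\<Sum>u\<in>V. \<Sum>x\<in>V. of_bool (adj x u))"
      unfolding kappa[symmetric] Msum using M by (simp add: algebra_simps)
    show "(\<Sum>x\<in>V. \<Sum>y\<in>V. \<Sum>u\<in>V. \<Sum>v\<in>V. of_bool (\<not> F x y) * of_bool (\<not> F u v) *
      (of_bool (adj x u) * of_bool (adj y u) * (of_bool (adj x v) * of_bool (adj y v))))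
       \<le> ((\<psi>\<^sup>2 / 150) ^ 4 / 10) ^ 3 * real l ^ 4"
      unfolding kappa[symmetric]
      using good_tuples_le[OF P] few unfolding V_def F_def adj_def by linarith
  qed
  obtain Z where Z: "Z \<subseteq> V" "real (card Z) \<le> (1 + 16 * \<psi>) * real l"
    "(1 - 7 * \<psi>) * (real l)\<^sup>2 \<le> (\<Sum>u\<in>Z. \<Sum>v\<in>Z. of_bool (F u v))"
    using dense_pregraph.near_clique[OF dense] by blast
  have "l \<le> n" using dense_pregraph.l_le_n[OF dense] by (simp add: V_def)
  then show ?thesis
    using near_clique_imp_close[of E n l \<psi> \<epsilon> Z] ME E psi l1 Z by (simp add: V_def F_def)
qed

theorem theorem1p6:
  shows "\<forall>\<epsilon>::real. \<epsilon> > 0 \<longrightarrow>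
    (\<exists>C \<delta> \<beta> :: real. C > 0 \<and> \<delta> > 0 \<and> \<beta> > 0 \<and>
      (\<forall>(l::nat) (n::nat) M E.
        n \<ge> 1 \<longrightarrow>
        real l \<ge> C * sqrt (real n) \<longrightarrow>
        pregraph n M E \<longrightarrow>
        card E \<le> l choose 2 \<longrightarrow>
        real (card M) \<ge> (1 - \<delta>) * real l * real n \<longrightarrow>
        close_to_complete \<epsilon> l n E \<or>
        real (card (good_C4_copies n M E)) \<ge> \<beta> * real l ^ 4))"
proof (intro allI impI)
  fix \<epsilon> :: real assume eps: "\<epsilon> > 0"
  \<comment> \<open>\<open>\<psi>\<close> meets the bounds of \<open>near_clique_imp_close\<close>.
    In the witness \<open>\<kappa> ^ 3 / 256\<close> the denominator cancels the factor from
    \<open>good_tuples_le\<close>.\<close>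
  define \<psi> where "\<psi> = min (1/100) (\<epsilon> / 300)"
  define \<kappa> where "\<kappa> = (\<psi>\<^sup>2 / 150) ^ 4 / 10"
  have psi: "0 < \<psi>" "\<psi> \<le> 1/100" "300 * \<psi> \<le> \<epsilon>" using eps by (auto simp: \<psi>_def)
  have "0 < \<kappa>" using psi by (simp add: \<kappa>_def)
  then show "\<exists>C \<delta> \<beta> :: real. C > 0 \<and> \<delta> > 0 \<and> \<beta> > 0 \<and>
      (\<forall>(l::nat) (n::nat) M E.
        n \<ge> 1 \<longrightarrow>
        real l \<ge> C * sqrt (real n) \<longrightarrow>
        pregraph n M E \<longrightarrow>
        card E \<le> l choose 2 \<longrightarrow>
        real (card M) \<ge> (1 - \<delta>) * real l * real n \<longrightarrow>
        close_to_complete \<epsilon> l n E \<or>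
        real (card (good_C4_copies n M E)) \<ge> \<beta> * real l ^ 4)"
    using close_or_many_good_C4[OF psi \<kappa>_def]
    by (intro exI[of _ "1 / \<kappa>"] exI[of _ \<kappa>] exI[of _ "\<kappa> ^ 3 / 256"]) (auto simp: not_le[symmetric])
qed

end
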